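(* For every connected distance space $(X,d)$ having at least two points, $\mathsf{Cob}^\omega(X,d)$ is a nonseparably connected completely metrizable space.
   Context: A distance space is a pair $(X,d)$ where $d\colon X\times X\to[0,\infty)$ is any function with $d(x,x)=0$ for all $x\in X$ (no symmetry or triangle inequality is assumed). Put $B_d(x,r)=\{z\in X: d(x,z)<r\}$. The topology of $(X,d)$: a set $E\subset X$ is open iff for every $x\in E$ there is $r>0$ with $B_d(x,r)\subset E$. Complete oriented graph. For a set $X$ and distinct $x,y\in X$ the oriented edge is $[x,y]=\{x,y\}\cup\{(x,y,t): t\in(0,1)\}$, where the points $(x,y,t)$ are pairwise distinct for distinct triples and do not belong to $X$; thus $[x,y]\cap[y,x]=\{x,y\}$. Let $\Gamma(X)=X\cup\bigcup\{[x,y]: x,y\in X,\ x\ne y\}$. On pairs of points of a common edge define, for distinct $x,y\in X$ and $t,s\in(0,1)$: $r(x,x)=0$, $r(x,y)=1$, $r((x,y,t),(x,y,s))=|t-s|$, $r(x,(x,y,t))=r((x,y,t),x)=t$, $r(y,(x,y,t))=r((x,y,t),y)=1-t$. For $a,b\in\Gamma(X)$ let $\rho(a,b)$ be the infimum of $\sum_{i=1}^n r(a_i,a_{i-1})$ over all finite sequences $a=a_0,a_1,\dots,a_n=b$ in $\Gamma(X)$ such that any two consecutive points lie on a common edge (with $\rho(a,a)=0$). Then $\rho$ is a metric on $\Gamma(X)$ and each edge is isometric to $[0,1]$. Cobweb. Let $(X,d)$ be a distance space and $d_1=\min\{d,1/2\}$. For distinct $a,b\in X$ let $a_b\in[a,b]$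 be the unique point with $\rho(a_b,b)=d_1(b,a)$, and let $[a,a_b]=\{z\in[a,b]:\rho(a,z)\le 1-d_1(b,a)\}$. Let $Z_a=\{a\}\cup\bigcup\{[a,a_b]\setminus\{b\}: b\in X\setminus\{a\}\}$. The cobweb over $(X,d)$ is $\mathsf{Cob}(X,d)=\bigcup_{a\in X}Z_a\subset\Gamma(X)$ with the metric $\rho$ restricted from $\Gamma(X)$. The sets $Z_a$ are pairwise disjoint, and the compression map $\pi\colon\mathsf{Cob}(X,d)\to X$ is defined by $\pi(Z_a)=\{a\}$ for all $a\in X$. Iterated cobwebs. Let $\mathsf{Cob}^1(X,d)=\mathsf{Cob}(X,d)$ with its cobweb metric $\rho_1$ (the restriction of the metric of $\Gamma(X)$), and inductively $\mathsf{Cob}^{n+1}(X,d)=\mathsf{Cob}(\mathsf{Cob}^n(X,d),\rho_n)$ with its cobweb metric $\rho_{n+1}$ (the restriction of the metric of $\Gamma(\mathsf{Cob}^n(X,d))$). Let $\pi^{n+1}_n\colon\mathsf{Cob}^{n+1}(X,d)\to\mathsf{Cob}^n(X,d)$ be the compression maps. Then $\mathsf{Cob}^\omega(X,d)=\{(x_n)_{n=1}^\infty\in\prod_{n\in\mathbb N}\mathsf{Cob}^n(X,d):\pi^{n+1}_n(x_{n+1})=x_n\text{ for all }n\in\mathbb N\}$ is the inverse limit, with the subspace topology of the product topology. A topological space is nonseparably connected if it is connected but all of its connected separable subspaces are singletons (equivalently, every separablewise component, i.e. the union of all separable connected subsets containing a given point, is a singleton). *)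

theory Defs
  imports "HOL-Analysis.Analysis"
begin

section \<open>Distance spaces\<close>

definition distance_space :: "'a set \<Rightarrow> ('a \<Rightarrow> 'a \<Rightarrow> real) \<Rightarrow> bool" where
  "distance_space X d \<longleftrightarrow> (\<forall>x\<in>X. \<forall>y\<in>X. 0 \<le> d x y) \<and> (\<forall>x\<in>X. d x x = 0)"

definition dball :: "'a set \<Rightarrow> ('a \<Rightarrow> 'a \<Rightarrow> real) \<Rightarrow> 'a \<Rightarrow> real \<Rightarrow> 'a set" where
  "dball X d x r = {z \<in> X. d x z < r}"

definition dopen :: "'a set \<Rightarrow> ('a \<Rightarrow> 'a \<Rightarrow> real) \<Rightarrow> 'a set \<Rightarrow> bool" where
  "dopen X d E \<longleftrightarrow> E \<subseteq> X \<and> (\<forall>x\<in>E. \<exists>r>0. dball X d x r \<subseteq> E)"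

definition distance_topology :: "'a set \<Rightarrow> ('a \<Rightarrow> 'a \<Rightarrow> real) \<Rightarrow> 'a topology" where
  "distance_topology X d = topology (dopen X d)"

lemma istopology_dopen: "istopology (dopen X d)"
proof -
  have "dopen X d (S \<inter> T)" if S: "dopen X d S" and T: "dopen X d T" for S T
    unfolding dopen_def
  proof (intro conjI ballI)
    show "S \<inter> T \<subseteq> X" using S by (auto simp: dopen_def)
    fix x assume "x \<in> S \<inter> T"
    then obtain r s where rs: "r > 0" "dball X d x r \<subseteq> S" "s > 0" "dball X d x s \<subseteq> T"
      using S T unfolding dopen_def by (metis IntE)
    then show "\<exists>r>0. dball X d x r \<subseteq> S \<inter> T"
      by (intro exI[of _ "min r s"]) (auto simp: dball_def)
  qed
  moreover have "dopen X d (\<Union>\<K>)" if "\<forall>K\<in>\<K>. dopen X d K" for \<K>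
    using that unfolding dopen_def by (meson Sup_le_iff Union_iff Union_upper order_trans)
  ultimately show ?thesis by (simp add: istopology_def)
qed

lemma openin_distance_topology: "openin (distance_topology X d) = dopen X d"
  by (simp add: distance_topology_def istopology_dopen topology_inverse')

lemma topspace_distance_topology: "topspace (distance_topology X d) = X"
proof -
  have "dopen X d X" by (auto simp: dopen_def dball_def intro: exI[of _ 1])
  then show ?thesis
    by (auto simp: topspace_def openin_distance_topology) (auto simp: dopen_def)
qed


section \<open>The complete oriented graph\<close>

text \<open>The iteration of the cobweb construction needs a single type that is closed under passing
  from \<open>X\<close> to \<open>\<Gamma>(X)\<close>. The points of the initial space are \<open>Leaf x\<close>. If \<open>X\<close> is a set of points,
  then the copy of \<open>x \<in> X\<close> in \<open>\<Gamma>(X)\<close> is \<open>Vtx x\<close>, and the point \<open>(x,y,t)\<close> of the edge \<open>[x,y]\<close> is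
  \<open>Pt x y t\<close>. Tagging the vertices guarantees that the new points \<open>(x,y,t)\<close> never
  belong to (the copy of) \<open>X\<close>, even if \<open>X\<close> itself already contains edge points.\<close>

datatype 'a web = Leaf 'a | Vtx "'a web" | Pt "'a web" "'a web" real

definition edge :: "'a web \<Rightarrow> 'a web \<Rightarrow> 'a web set" where
  "edge x y = {Vtx x, Vtx y} \<union> {Pt x y t |t. 0 < t \<and> t < 1}"

definition cgraph :: "'a web set \<Rightarrow> 'a web set" where
  "cgraph X = Vtx ` X \<union> \<Union>{edge x y |x y. x \<in> X \<and> y \<in> X \<and> x \<noteq> y}"

definition on_common_edge :: "'a web set \<Rightarrow> 'a web \<Rightarrow> 'a web \<Rightarrow> bool" where
  "on_common_edge X p q \<longleftrightarrow>
     (\<exists>x\<in>X. \<exists>y\<in>X. x \<noteq> y \<and> p \<in> edge x y \<and> q \<in> edge x y)"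

text \<open>This is the function \<open>r\<close> on pairs of points of a common edge; in particular, in the second
  and third equation \<open>z\<close> is one of \<open>x\<close>, \<open>y\<close>, and the fourth one is applied only when \<open>x' = x\<close> and
  \<open>y' = y\<close>. Other values are irrelevant.\<close>

fun edge_dist :: "'a web \<Rightarrow> 'a web \<Rightarrow> real" where
  "edge_dist (Vtx x) (Vtx y) = (if x = y then 0 else 1)"
| "edge_dist (Vtx z) (Pt x y t) = (if z = x then t else 1 - t)"
| "edge_dist (Pt x y t) (Vtx z) = (if z = x then t else 1 - t)"
| "edge_dist (Pt x y t) (Pt x' y' s) = \<bar>t - s\<bar>"
| "edge_dist _ _ = 0"

definition chain_lengths :: "'a web set \<Rightarrow> 'a web \<Rightarrow> 'a web \<Rightarrow> real set" where
  "chain_lengths X a b =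
     {(\<Sum>i=1..n. edge_dist (c i) (c (i - 1))) |(n::nat) c.
        c 0 = a \<and> c n = b \<and> (\<forall>i\<in>{1..n}. on_common_edge X (c i) (c (i - 1)))}"

text \<open>The value \<open>0\<close> outside of \<open>\<Gamma>(X)\<close> is a convention: the library's \<^locale>\<open>Metric_space\<close> requires
  nonnegativity and symmetry on the whole type.\<close>

definition graph_dist :: "'a web set \<Rightarrow> 'a web \<Rightarrow> 'a web \<Rightarrow> real" where
  "graph_dist X a b = (if a \<in> cgraph X \<and> b \<in> cgraph X then Inf (chain_lengths X a b) else 0)"

lemma edge_dist_commute: "on_common_edge X p q \<Longrightarrow> edge_dist p q = edge_dist q p"
  by (auto simp: on_common_edge_def edge_def)

lemma on_common_edge_commute: "on_common_edge X p q \<Longrightarrow> on_common_edge X q p"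
  by (auto simp: on_common_edge_def)

lemma edge_dist_nonneg: "on_common_edge X p q \<Longrightarrow> 0 \<le> edge_dist p q"
  by (auto simp: on_common_edge_def edge_def)

lemma chain_lengths_nonneg: "s \<in> chain_lengths X a b \<Longrightarrow> 0 \<le> s"
  by (auto simp: chain_lengths_def intro!: sum_nonneg edge_dist_nonneg)

lemma bdd_below_chain_lengths: "bdd_below (chain_lengths X a b)"
  using chain_lengths_nonneg by (meson bdd_belowI)

lemma chain_lengths_refl: "0 \<in> chain_lengths X a a"
  unfolding chain_lengths_def by (rule CollectI, rule exI[of _ 0], rule exI[of _ "\<lambda>_. a"]) simp

lemma chain_lengths_single:
  assumes "on_common_edge X a b"
  shows "edge_dist a b \<in> chain_lengths X a b"
proof -
  have "on_common_edge X b a" "edge_dist b a = edge_dist a b"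
    using assms on_common_edge_commute edge_dist_commute by metis+
  then show ?thesis
    unfolding chain_lengths_def
    by (intro CollectI exI[of _ "Suc 0"] exI[of _ "\<lambda>i::nat. if i = 0 then a else b"]) auto
qed

lemma chain_lengths_commute:
  assumes "s \<in> chain_lengths X a b"
  shows "s \<in> chain_lengths X b a"
proof -
  obtain n c where c: "c 0 = a" "c n = b"
    "\<forall>i\<in>{1..n::nat}. on_common_edge X (c i) (c (i - 1))"
    and s: "s = (\<Sum>i=1..n. edge_dist (c i) (c (i - 1)))"
    using assms by (auto simp: chain_lengths_def)
  define e where "e i = c (n - i)" for i
  have step: "on_common_edge X (e i) (e (i - 1)) \<and>
      edge_dist (e i) (e (i - 1)) = edge_dist (c (n + 1 - i)) (c (n + 1 - i - 1))"
    if "i \<in> {1..n}" for i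
  proof -
    have "n + 1 - i \<in> {1..n}" "n + 1 - i - 1 = n - i" "n + 1 - i = n - (i - 1)"
      using that by auto
    with c(3) have "on_common_edge X (c (n - (i - 1))) (c (n - i))" by metis
    then show ?thesis
      unfolding e_def using \<open>n + 1 - i - 1 = n - i\<close> \<open>n + 1 - i = n - (i - 1)\<close>
      by (metis edge_dist_commute on_common_edge_commute)
  qed
  have "s = (\<Sum>i=1..n. edge_dist (c (n + 1 - i)) (c (n + 1 - i - 1)))"
    unfolding s by (rule sum.reindex_bij_witness[of _ "\<lambda>i. n + 1 - i" "\<lambda>i. n + 1 - i"]) auto
  also have "\<dots> = (\<Sum>i=1..n. edge_dist (e i) (e (i - 1)))"
    using step by (intro sum.cong) auto
  finally show ?thesis
    unfolding chain_lengths_def using c step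
    by (intro CollectI exI[of _ n] exI[of _ e]) (auto simp: e_def)
qed

lemma chain_lengths_trans:
  assumes "s \<in> chain_lengths X a b" "t \<in> chain_lengths X b e"
  shows "s + t \<in> chain_lengths X a e"
proof -
  obtain n c where c: "c 0 = a" "c n = b"
    "\<forall>i\<in>{1..n::nat}. on_common_edge X (c i) (c (i - 1))"
    and s: "s = (\<Sum>i=1..n. edge_dist (c i) (c (i - 1)))"
    using assms(1) by (auto simp: chain_lengths_def)
  obtain m g where g: "g 0 = b" "g m = e"
    "\<forall>i\<in>{1..m::nat}. on_common_edge X (g i) (g (i - 1))"
    and t: "t = (\<Sum>i=1..m. edge_dist (g i) (g (i - 1)))"
    using assms(2) by (auto simp: chain_lengths_def)
  define h where "h i = (if i \<le> n then c i else g (i - n))" for i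
  have h1: "h i = c i" "h (i - 1) = c (i - 1)" if "i \<in> {1..n}" for i
    using that by (auto simp: h_def)
  have h2: "h (i + n) = g i" "h (i + n - 1) = g (i - 1)" if "i \<in> {1..m}" for i
    using that c g by (auto simp: h_def) (cases i; simp)
  have "on_common_edge X (h i) (h (i - 1))" if "i \<in> {1..n + m}" for i
  proof (cases "i \<le> n")
    case True
    then show ?thesis using h1 c that by auto
  next
    case False
    then have "i - n \<in> {1..m}" "i - n + n = i" using that by auto
    then show ?thesis using h2[of "i - n"] g by metis
  qed
  moreover have "s + t = (\<Sum>i=1..n + m. edge_dist (h i) (h (i - 1)))"
  proof -
    have "(\<Sum>i=1..n + m. edge_dist (h i) (h (i - 1))) =
        (\<Sum>i=1..n. edge_dist (h i) (h (i - 1))) + (\<Sum>i=n+1..n+m. edge_dist (h i) (h (i - 1)))"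
      by (rule sum.ub_add_nat) simp
    also have "(\<Sum>i=n+1..n+m. edge_dist (h i) (h (i - 1))) = t"
      unfolding t
    proof (rule sum.reindex_bij_witness[of _ "\<lambda>i. i + n" "\<lambda>i. i - n"])
      fix i assume "i \<in> {n+1..n+m}"
      then have "i - n \<in> {1..m}" "i - n + n = i" by auto
      then show "edge_dist (g (i - n)) (g (i - n - 1)) = edge_dist (h i) (h (i - 1))"
        using h2[of "i - n"] by metis
    qed auto
    also have "(\<Sum>i=1..n. edge_dist (h i) (h (i - 1))) = s"
      unfolding s using h1 by (intro sum.cong) auto
    finally show ?thesis by simp
  qed
  moreover have "h 0 = a" "h (n + m) = e"
    using c g by (auto simp: h_def)
  ultimately show ?thesis
    unfolding chain_lengths_def by blast
qed

lemma chain_lengths_lipschitz: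
  assumes "s \<in> chain_lengths X a b"
    and "\<And>p q. on_common_edge X p q \<Longrightarrow> f p - f q \<le> edge_dist p q"
  shows "f b - f a \<le> s"
proof -
  obtain n c where c: "c 0 = a" "c n = b"
    "\<forall>i\<in>{1..n::nat}. on_common_edge X (c i) (c (i - 1))"
    and s: "s = (\<Sum>i=1..n. edge_dist (c i) (c (i - 1)))"
    using assms(1) by (auto simp: chain_lengths_def)
  have "f (c k) - f (c 0) \<le> (\<Sum>i=1..k. edge_dist (c i) (c (i - 1)))" if "k \<le> n" for k
    using that
  proof (induction k)
    case (Suc k)
    have "f (c (Suc k)) - f (c k) \<le> edge_dist (c (Suc k)) (c k)"
      using c(3) Suc.prems by (intro assms(2)) force
    then show ?case using Suc by simp
  qed simp
  then show ?thesis using c s by auto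
qed

lemma chain_lengths_nonempty:
  assumes "a \<in> cgraph X" "b \<in> cgraph X"
  shows "chain_lengths X a b \<noteq> {}"
proof -
  have to_vertex: "\<exists>x\<in>X. \<exists>s. s \<in> chain_lengths X a (Vtx x)" if a: "a \<in> cgraph X" for a
  proof -
    consider x where "x \<in> X" "a = Vtx x" | x y where "x \<in> X" "y \<in> X" "x \<noteq> y" "a \<in> edge x y"
      using a by (auto simp: cgraph_def)
    then show ?thesis
    proof cases
      case 1
      then show ?thesis using chain_lengths_refl by blast
    next
      case 2
      then have "on_common_edge X a (Vtx x)"
        by (auto simp: on_common_edge_def edge_def)
      then show ?thesis using 2 chain_lengths_single by blast
    qed
  qed
  obtain x s where x: "x \<in> X" "s \<in> chain_lengths X a (Vtx x)"
    using to_vertex[OF assms(1)] by blast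
  obtain y t where y: "y \<in> X" "t \<in> chain_lengths X b (Vtx y)"
    using to_vertex[OF assms(2)] by blast
  obtain u where "u \<in> chain_lengths X (Vtx x) (Vtx y)"
  proof (cases "x = y")
    case True
    then show ?thesis using that chain_lengths_refl by blast
  next
    case False
    then have "on_common_edge X (Vtx x) (Vtx y)"
      using x y by (auto simp: on_common_edge_def edge_def)
    then show ?thesis using that chain_lengths_single by blast
  qed
  then show ?thesis
    using x y chain_lengths_commute chain_lengths_trans by blast
qed

text \<open>Functions that are 1-Lipschitz along edges, vanish at a given point of \<open>\<Gamma>(X)\<close> and are
  positive at all others; they bound \<open>\<rho>\<close> from below.\<close>

fun from_vtx :: "'a web \<Rightarrow> 'a web \<Rightarrow> real" where
  "from_vtx x (Vtx y) = (if y = x then 0 else 1)"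
| "from_vtx x (Pt y z t) = (if y = x then t else if z = x then 1 - t else 1)"
| "from_vtx x (Leaf _) = 0"

fun from_pt :: "'a web \<Rightarrow> 'a web \<Rightarrow> real \<Rightarrow> 'a web \<Rightarrow> real" where
  "from_pt x y t (Pt x' y' s) =
     (if x' = x \<and> y' = y then min \<bar>t - s\<bar> (min t (1 - t)) else min t (1 - t))"
| "from_pt x y t _ = min t (1 - t)"

lemma from_vtx_lipschitz:
  "on_common_edge X p q \<Longrightarrow> from_vtx x p - from_vtx x q \<le> edge_dist p q"
  by (auto simp: on_common_edge_def edge_def)

lemma from_pt_lipschitz:
  "on_common_edge X p q \<Longrightarrow> 0 < t \<Longrightarrow> t < 1 \<Longrightarrow> from_pt x y t p - from_pt x y t q \<le> edge_dist p q"
  by (auto simp: on_common_edge_def edge_def)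

lemma graph_dist_ge:
  assumes "a \<in> cgraph X" "b \<in> cgraph X"
    and "\<And>p q. on_common_edge X p q \<Longrightarrow> f p - f q \<le> edge_dist p q"
  shows "f b - f a \<le> graph_dist X a b"
proof -
  have "f b - f a \<le> Inf (chain_lengths X a b)"
    by (rule cInf_greatest[OF chain_lengths_nonempty[OF assms(1,2)]])
      (rule chain_lengths_lipschitz[OF _ assms(3)])
  then show ?thesis using assms by (simp add: graph_dist_def)
qed

lemma graph_dist_pos:
  assumes "a \<in> cgraph X" "b \<in> cgraph X" "a \<noteq> b"
  shows "0 < graph_dist X a b"
proof -
  consider x where "a = Vtx x" | x y t where "a = Pt x y t" "0 < t" "t < 1"
    using assms(1) by (auto simp: cgraph_def edge_def)
  then show ?thesis
  proof cases
    case 1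
    have "0 < from_vtx x b - from_vtx x a"
      using assms 1 by (auto simp: cgraph_def edge_def split: if_splits)
    then show ?thesis
      using graph_dist_ge[OF assms(1,2) from_vtx_lipschitz] by (meson less_le_trans)
  next
    case 2
    have "0 < from_pt x y t b - from_pt x y t a"
      using assms 2 by (auto simp: cgraph_def edge_def split: if_splits)
    then show ?thesis
      using graph_dist_ge[OF assms(1,2) from_pt_lipschitz] 2 by (meson less_le_trans)
  qed
qed

lemma Metric_space_graph_dist: "Metric_space (cgraph X) (graph_dist X)"
proof
  fix a b
  show "0 \<le> graph_dist X a b"
    using chain_lengths_nonneg chain_lengths_nonempty
    unfolding graph_dist_def by (metis cInf_greatest order_refl)
  have "chain_lengths X a b = chain_lengths X b a"
    using chain_lengths_commute by blast
  then show "graph_dist X a b = graph_dist X b a"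
    by (simp add: graph_dist_def)
next
  fix a b assume ab: "a \<in> cgraph X" "b \<in> cgraph X"
  have "graph_dist X a a = 0"
    using ab(1) chain_lengths_refl chain_lengths_nonneg
    by (auto simp: graph_dist_def intro!: cInf_eq_minimum)
  then show "graph_dist X a b = 0 \<longleftrightarrow> a = b"
    using graph_dist_pos[OF ab] by (cases "a = b") auto
next
  fix a b e assume abe: "a \<in> cgraph X" "b \<in> cgraph X" "e \<in> cgraph X"
  have "Inf (chain_lengths X a e) - t \<le> Inf (chain_lengths X a b)"
    if t: "t \<in> chain_lengths X b e" for t
  proof (rule cInf_greatest[OF chain_lengths_nonempty[OF abe(1,2)]])
    fix s assume "s \<in> chain_lengths X a b"
    then have "Inf (chain_lengths X a e) \<le> s + t"
      using t chain_lengths_trans bdd_below_chain_lengths by (intro cInf_lower) blast+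
    then show "Inf (chain_lengths X a e) - t \<le> s" by simp
  qed
  then have "Inf (chain_lengths X a e) - Inf (chain_lengths X a b) \<le> Inf (chain_lengths X b e)"
    using chain_lengths_nonempty[OF abe(2,3)]
    by (intro cInf_greatest) (auto simp: algebra_simps)
  then show "graph_dist X a e \<le> graph_dist X a b + graph_dist X b e"
    using abe by (simp add: graph_dist_def)
qed


section \<open>Cobwebs\<close>

text \<open>The segment \<open>[a, a\<^sub>b]\<close> of the edge \<open>[a,b]\<close>; note the order of the arguments in \<open>d b a\<close>.\<close>

definition cob_segment ::
    "'a web set \<Rightarrow> ('a web \<Rightarrow> 'a web \<Rightarrow> real) \<Rightarrow> 'a web \<Rightarrow> 'a web \<Rightarrow> 'a web set" where
  "cob_segment X d a b = {z \<in> edge a b. graph_dist X (Vtx a) z \<le> 1 - min (d b a) (1/2)}"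

definition cob_part ::
    "'a web set \<Rightarrow> ('a web \<Rightarrow> 'a web \<Rightarrow> real) \<Rightarrow> 'a web \<Rightarrow> 'a web set" where
  "cob_part X d a = {Vtx a} \<union> (\<Union>b \<in> X - {a}. cob_segment X d a b - {Vtx b})"

definition cobweb :: "'a web set \<Rightarrow> ('a web \<Rightarrow> 'a web \<Rightarrow> real) \<Rightarrow> 'a web set" where
  "cobweb X d = (\<Union>a\<in>X. cob_part X d a)"

definition compression ::
    "'a web set \<Rightarrow> ('a web \<Rightarrow> 'a web \<Rightarrow> real) \<Rightarrow> 'a web \<Rightarrow> 'a web" where
  "compression X d z = (THE a. a \<in> X \<and> z \<in> cob_part X d a)"

lemma cob_segment_eq:
  assumes "a \<in> X" "b \<in> X" "a \<noteq> b" "0 \<le> d b a"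
  shows "cob_segment X d a b = {Vtx a} \<union> (if d b a = 0 then {Vtx b} else {}) \<union>
    {Pt a b t |t. 0 < t \<and> t < 1 \<and> t \<le> 1 - min (d b a) (1/2)}"
proof -
  have "graph_dist X (Vtx a) z = from_vtx a z" if z: "z \<in> edge a b" for z
  proof (rule antisym)
    have on: "on_common_edge X (Vtx a) z"
      using assms z by (auto simp: on_common_edge_def edge_def)
    have mem: "Vtx a \<in> cgraph X" "z \<in> cgraph X"
      using assms z by (auto simp: cgraph_def)
    show "from_vtx a z \<le> graph_dist X (Vtx a) z"
      using graph_dist_ge[OF mem from_vtx_lipschitz[where x = a]] by simp
    have "graph_dist X (Vtx a) z \<le> edge_dist (Vtx a) z"
      using mem cInf_lower[OF chain_lengths_single[OF on] bdd_below_chain_lengths]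
      by (simp add: graph_dist_def)
    also have "\<dots> = from_vtx a z"
      using z assms by (auto simp: edge_def)
    finally show "graph_dist X (Vtx a) z \<le> from_vtx a z" .
  qed
  then show ?thesis
    using assms unfolding cob_segment_def by (auto simp: edge_def)
qed

lemma cobweb_subset: "cobweb X d \<subseteq> cgraph X"
  by (auto simp: cobweb_def cob_part_def cob_segment_def cgraph_def)


section \<open>Iterated cobwebs and their inverse limit\<close>

text \<open>Stage \<open>0\<close> is the given distance space \<open>(X,d)\<close> itself, stage \<open>n \<ge> 1\<close> is \<open>Cob\<^sup>n(X,d)\<close> with the
  metric \<open>\<rho>\<^sub>n\<close>, which is restricted from the graph over the previous stage.\<close>

fun cob_set :: "'a set \<Rightarrow> ('a \<Rightarrow> 'a \<Rightarrow> real) \<Rightarrow> nat \<Rightarrow> 'a web set"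
  and cob_dist :: "'a set \<Rightarrow> ('a \<Rightarrow> 'a \<Rightarrow> real) \<Rightarrow> nat \<Rightarrow> 'a web \<Rightarrow> 'a web \<Rightarrow> real" where
  "cob_set X d 0 = Leaf ` X"
| "cob_set X d (Suc n) = cobweb (cob_set X d n) (cob_dist X d n)"
| "cob_dist X d 0 = (\<lambda>p q. case (p, q) of (Leaf x, Leaf y) \<Rightarrow> d x y | _ \<Rightarrow> 0)"
| "cob_dist X d (Suc n) = graph_dist (cob_set X d n)"

lemma Metric_space_cob: "Metric_space (cob_set X d (Suc n)) (cob_dist X d (Suc n))"
  using Metric_space.subspace[OF Metric_space_graph_dist cobweb_subset] by simp

lemma compression_eq:
  assumes "a \<in> X" "z \<in> cob_part X d a"
  shows "compression X d z = a"
  unfolding compression_def using assms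
  by (intro the_equality) (auto simp: cob_part_def cob_segment_def edge_def)

definition cob_topology :: "'a set \<Rightarrow> ('a \<Rightarrow> 'a \<Rightarrow> real) \<Rightarrow> nat \<Rightarrow> 'a web topology" where
  "cob_topology X d n = Metric_space.mtopology (cob_set X d n) (cob_dist X d n)"

definition cob_limit_set :: "'a set \<Rightarrow> ('a \<Rightarrow> 'a \<Rightarrow> real) \<Rightarrow> (nat \<Rightarrow> 'a web) set" where
  "cob_limit_set X d =
     {x \<in> (\<Pi>\<^sub>E n\<in>{1..}. cob_set X d n).
        \<forall>n\<ge>1. compression (cob_set X d n) (cob_dist X d n) (x (Suc n)) = x n}"

definition cob_limit :: "'a set \<Rightarrow> ('a \<Rightarrow> 'a \<Rightarrow> real) \<Rightarrow> (nat \<Rightarrow> 'a web) topology" where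
  "cob_limit X d =
     subtopology (product_topology (cob_topology X d) {1..}) (cob_limit_set X d)"


section \<open>Nonseparable connectedness\<close>

definition nonseparably_connected :: "'a topology \<Rightarrow> bool" where
  "nonseparably_connected T \<longleftrightarrow>
     connected_space T \<and>
     (\<forall>S. S \<noteq> {} \<and> connectedin T S \<and> separable_space (subtopology T S) \<longrightarrow> (\<exists>x. S = {x}))"

end

theory Submission
  imports Defs
begin

text \<open>Write \<open>\<pi>\<^sub>n\<close> for the compression map from stage \<open>n + 1\<close> to stage \<open>n\<close> of the iterated cobweb
  construction, stage \<open>0\<close> being the distance space \<open>(X,d)\<close> itself.

  \<^emph>\<open>Connectedness.\<close> A clopen subset \<open>U\<close> of the limit divides the points of each stage into three
  kinds: those whose fibre lies in \<open>U\<close>, those whose fibre misses \<open>U\<close>, and the mixed ones. A point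
  \<open>a\<close> lies on the thread of the vertices over \<open>a\<close>. A neighbourhood of this thread that lies in \<open>U\<close>
  or misses \<open>U\<close> contains a small ball at some late stage, and the projection of this ball contains
  a ball around \<open>a\<close>: whenever \<open>d a b\<close> is small, the part of the
  cobweb over \<open>b\<close> contains points close to the vertex \<open>a\<close> (\<open>cobweb_lift\<close>). Hence the membership of
  the fibres in \<open>U\<close> is locally constant along every set without mixed points. Since the base is
  connected, there is a mixed point at stage \<open>0\<close> if \<open>U\<close> is neither empty nor everything; since the
  fibres of \<open>\<pi>\<^sub>n\<close> are connected (\<open>cob_part_connected\<close>), each mixed point has a mixed point above it.
  So some thread consists of mixed points only, but a basic open set around this thread inside \<open>U\<close>
  or its complement shows that one of its points is not mixed. This is
  \<open>locally_constant_on_threads\<close>.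

  \<^emph>\<open>Absence of separable connected subsets.\<close> Let \<open>C\<close> be a connected subset of the cobweb over a
  metric space. If \<open>C\<close> meets the part over \<open>a\<close> without containing the vertex \<open>a\<close>, then it is trapped
  in a single edge, because the end of the edge segment towards the other vertex has been cut off
  at a positive distance (\<open>connected_in_edge_of_missing_vertex\<close>). Otherwise the
  image of \<open>C\<close> under the compression map consists of points whose vertices are in \<open>C\<close>. Distinct
  vertices have distance \<open>1\<close>, so for separable \<open>C\<close> this image is countable; being a connected
  subset of a metric space, it is a single point. From stage \<open>1\<close> on all stages are metric spaces,
  so a separable connected subset of the limit has only one point in each coordinate.

  \<^emph>\<open>Complete metrizability.\<close> The cobweb is complete in the graph metric (\<open>mcomplete_cobweb\<close>), and
  the limit is closed in the countable product of the stages because the compression maps are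
  continuous.\<close>

section \<open>Distance topologies\<close>

lemma connected_distance_imp_locally_constant:
  assumes "connected_space (distance_topology C d)"
    and loc: "\<And>a. a \<in> C \<Longrightarrow> \<exists>r>0. \<forall>b\<in>C. d a b < r \<longrightarrow> Q b = Q a"
    and "a \<in> C" "b \<in> C" "Q a"
  shows "Q b"
proof -
  have "dopen C d {c \<in> C. Q c = v}" for v
    using loc by (fastforce simp: dopen_def dball_def)
  then have op: "openin (distance_topology C d) {c \<in> C. Q c = v}" for v
    by (simp add: openin_distance_topology)
  have "C - {c \<in> C. Q c = True} = {c \<in> C. Q c = False}" by auto
  then have "closedin (distance_topology C d) {c \<in> C. Q c = True}"
    using op[of False] by (auto simp: closedin_def topspace_distance_topology)
  then show ?thesis
    using assms op[of True] unfolding connected_space_clopen_in topspace_distance_topology by blast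
qed

text \<open>Working with the topology of a distance space throughout lets stage
  \<open>0\<close>, which is only a distance space, be treated like the later stages.\<close>

lemma (in Metric_space) mtopology_eq_distance_topology: "mtopology = distance_topology M d"
proof -
  have "mball x r = dball M d x r" if "x \<in> M" for x r
    using that by (auto simp: dball_def)
  then have "openin mtopology U = dopen M d U" for U
    unfolding openin_mtopology dopen_def by (metis subsetD)
  then show ?thesis
    by (simp add: topology_eq openin_distance_topology)
qed

text \<open>Only this direction of the \<open>\<epsilon>\<close>-\<open>\<delta>\<close> criterion holds in general: without a triangle inequality the
  balls \<open>dball\<close> need not be neighbourhoods of their centres.\<close>

lemma continuous_map_distance_topology:
  assumes "\<And>z. z \<in> C \<Longrightarrow> f z \<in> X"
    and "\<And>z e. z \<in> C \<Longrightarrow> e > 0 \<Longrightarrow> \<exists>r>0. \<forall>w\<in>C. \<rho> z w < r \<longrightarrow> d (f z) (f w) < e"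
  shows "continuous_map (distance_topology C \<rho>) (distance_topology X d) f"
  unfolding continuous_map_def topspace_distance_topology openin_distance_topology
proof (intro conjI allI impI)
  show "f \<in> C \<rightarrow> X" using assms(1) by auto
  fix E assume E: "dopen X d E"
  have "\<exists>r>0. dball C \<rho> z r \<subseteq> {z \<in> C. f z \<in> E}" if z: "z \<in> C" "f z \<in> E" for z
  proof -
    obtain e where e: "e > 0" "dball X d (f z) e \<subseteq> E"
      using E z by (auto simp: dopen_def)
    then obtain r where "r > 0" "\<forall>w\<in>C. \<rho> z w < r \<longrightarrow> d (f z) (f w) < e"
      using assms(2) z by blast
    then show ?thesis
      using e assms(1) by (intro exI[of _ r]) (auto simp: dball_def)
  qed
  then show "dopen C \<rho> {z \<in> C. f z \<in> E}"
    by (auto simp: dopen_def)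
qed

lemma (in Metric_space) distance_space: "distance_space M d"
  by (simp add: distance_space_def)

lemma (in Metric_space) subtopology_eq_distance_topology:
  assumes "C \<subseteq> M"
  shows "subtopology (distance_topology M d) C = distance_topology C d"
proof -
  interpret C: Submetric M d C
    by unfold_locales (use assms in auto)
  show ?thesis
    using C.mtopology_submetric C.sub.mtopology_eq_distance_topology mtopology_eq_distance_topology
    by simp
qed

section \<open>Connectedness of inverse limits\<close>

text \<open>An inverse sequence of distance spaces whose bonding maps have connected fibres and a section \<open>s\<close>,
  in general discontinuous, such that the image of a ball around \<open>s a\<close> contains the ball of the
  same radius around \<open>a\<close> (\<open>lift\<close>). Keeping the radius makes this property stable under the
  composition of bonding maps.\<close>

locale lifting_sequence =
  fixes S :: "nat \<Rightarrow> 'b set" and D :: "nat \<Rightarrow> 'b \<Rightarrow> 'b \<Rightarrow> real"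
    and p :: "nat \<Rightarrow> 'b \<Rightarrow> 'b" and s :: "'b \<Rightarrow> 'b"
  assumes cont: "continuous_map (distance_topology (S (Suc n)) (D (Suc n)))
        (distance_topology (S n) (D n)) (p n)"
    and section_in: "a \<in> S n \<Longrightarrow> s a \<in> S (Suc n)"
    and section_over: "a \<in> S n \<Longrightarrow> p n (s a) = a"
    and lift: "a \<in> S n \<Longrightarrow> b \<in> S n \<Longrightarrow> D n a b < r \<Longrightarrow>
        \<exists>c\<in>S (Suc n). p n c = b \<and> D (Suc n) (s a) c < r"
    and fibre_connected: "a \<in> S n \<Longrightarrow>
        connected_space (distance_topology {c \<in> S (Suc n). p n c = a} (D (Suc n)))"
    and base_connected: "connected_space (distance_topology (S 0) (D 0))"
begin

definition threads :: "(nat \<Rightarrow> 'b) set" where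
  "threads = {x. \<forall>n. x n \<in> S n \<and> p n (x (Suc n)) = x n}"

lemma thread_in: "x \<in> threads \<Longrightarrow> x n \<in> S n"
  and thread_step: "x \<in> threads \<Longrightarrow> p n (x (Suc n)) = x n"
  by (auto simp: threads_def)

lemma threads_agree_below:
  assumes "x \<in> threads" "y \<in> threads" "x m = y m" "n \<le> m"
  shows "x n = y n"
  using assms(4,3) by (induction rule: inc_induct) (use assms(1,2) thread_step in metis)+

text \<open>Below stage \<open>n\<close> the coordinates are forced by the bonding maps, above it the section provides
  them.\<close>

lemma thread_along_section:
  assumes "a \<in> S n"
  shows "\<exists>x\<in>threads. x n = a \<and> (\<forall>k\<ge>n. x (Suc k) = s (x k))"
proof -
  define up where "up b = rec_nat b (\<lambda>_. s)" for b
  have up: "up b 0 = b" "up b (Suc k) = s (up b k)" for b k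
    by (simp_all add: up_def)
  have up_in: "up b k \<in> S (n + k)" if "b \<in> S n" for b n k
    using that by (induction k) (auto simp: up section_in)
  show ?thesis
    using assms
  proof (induction n arbitrary: a)
    case 0
    then have "up a \<in> threads"
      using up_in[of a 0] by (auto simp: threads_def up section_over)
    then show ?case by (intro bexI[of _ "up a"]) (auto simp: up)
  next
    case (Suc n)
    have pa: "p n a \<in> S n"
      using cont[of n] Suc.prems by (auto simp: continuous_map_def topspace_distance_topology)
    then obtain x where x: "x \<in> threads" "x n = p n a" using Suc.IH by blast
    define y where "y k = (if k \<le> n then x k else up a (k - Suc n))" for k
    have y_up: "y k = up a (k - Suc n)" if "Suc n \<le> k" for k
      using that by (simp add: y_def)
    have "y k \<in> S k \<and> p k (y (Suc k)) = y k" for k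
    proof -
      consider "k < n" | "k = n" | "Suc n \<le> k" by linarith
      then show ?thesis
      proof cases
        case 3
        then have "up a (k - Suc n) \<in> S k" "Suc k - Suc n = Suc (k - Suc n)"
          using up_in[OF Suc.prems, of "k - Suc n"] by auto
        then show ?thesis
          using 3 by (simp add: y_up up section_over del: diff_Suc_Suc)
      qed (use x pa thread_in thread_step in \<open>auto simp: y_def up\<close>)
    qed
    then have "y \<in> threads" by (simp add: threads_def)
    moreover have "y (Suc k) = s (y k)" if "k \<ge> Suc n" for k
    proof -
      have "Suc k - Suc n = Suc (k - Suc n)" using that by simp
      then show ?thesis using that by (simp add: y_up up del: diff_Suc_Suc)
    qed
    ultimately show ?case
      by (intro bexI[of _ y]) (auto simp: y_def up)
  qed
qed

lemma thread_through: "a \<in> S n \<Longrightarrow> \<exists>x\<in>threads. x n = a"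
  using thread_along_section by blast

text \<open>A condition on one coordinate of a thread is an open condition on any later coordinate, by
  continuity of the bonding maps. Hence the open sets that restrict only one coordinate form a
  base of the topology of the limit.\<close>

lemma nbhd_at_later_stage:
  assumes x: "x \<in> threads" and W: "openin (distance_topology (S n) (D n)) W" "x n \<in> W"
    and "n \<le> m"
  shows "\<exists>V. openin (distance_topology (S m) (D m)) V \<and> x m \<in> V \<and>
    (\<forall>y\<in>threads. y m \<in> V \<longrightarrow> y n \<in> W)"
  using \<open>n \<le> m\<close>
proof (induction m rule: dec_induct)
  case base
  then show ?case using W by blast
next
  case (step m)
  then obtain V where V: "openin (distance_topology (S m) (D m)) V" "x m \<in> V"
    "\<forall>y\<in>threads. y m \<in> V \<longrightarrow> y n \<in> W" by blast
  have "openin (distance_topology (S (Suc m)) (D (Suc m))) {z \<in> S (Suc m). p m z \<in> V}"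
    using openin_continuous_map_preimage[OF cont V(1)] by (simp add: topspace_distance_topology)
  then show ?case
    using V x by (intro exI[of _ "{z \<in> S (Suc m). p m z \<in> V}"]) (auto simp: thread_in thread_step)
qed

lemma finite_nbhds_at_one_stage:
  assumes x: "x \<in> threads" and "finite J"
    and "\<And>i. i \<in> J \<Longrightarrow> openin (distance_topology (S i) (D i)) (W i) \<and> x i \<in> W i"
  shows "\<exists>n V. openin (distance_topology (S n) (D n)) V \<and> x n \<in> V \<and>
    (\<forall>y\<in>threads. y n \<in> V \<longrightarrow> (\<forall>i\<in>J. y i \<in> W i))"
  using assms(2,3)
proof (induction J)
  case empty
  have "openin (distance_topology (S 0) (D 0)) (S 0)"
    using openin_topspace topspace_distance_topology by metis
  then show ?case using thread_in[OF x] by blast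
next
  case (insert i J)
  then obtain n V where V: "openin (distance_topology (S n) (D n)) V" "x n \<in> V"
    "\<forall>y\<in>threads. y n \<in> V \<longrightarrow> (\<forall>i\<in>J. y i \<in> W i)" by auto
  have Wi: "openin (distance_topology (S i) (D i)) (W i)" "x i \<in> W i"
    using insert.prems by auto
  obtain A where A: "openin (distance_topology (S (max i n)) (D (max i n))) A" "x (max i n) \<in> A"
    "\<forall>y\<in>threads. y (max i n) \<in> A \<longrightarrow> y n \<in> V"
    using nbhd_at_later_stage[OF x V(1,2), of "max i n"] by auto
  obtain B where B: "openin (distance_topology (S (max i n)) (D (max i n))) B" "x (max i n) \<in> B"
    "\<forall>y\<in>threads. y (max i n) \<in> B \<longrightarrow> y i \<in> W i"
    using nbhd_at_later_stage[OF x Wi, of "max i n"] by auto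
  have "openin (distance_topology (S (max i n)) (D (max i n))) (A \<inter> B)"
    using A B by (intro openin_Int)
  then show ?case
    using A B V by (intro exI[of _ "max i n"] exI[of _ "A \<inter> B"]) simp
qed

text \<open>The lifting property, applied stage by stage along the section: every point near \<open>x n\<close> extends
  to a thread that is near \<open>x\<close> at the given later stage.\<close>

lemma close_point_close_thread:
  assumes x: "x \<in> threads" "\<forall>k\<ge>n. x (Suc k) = s (x k)"
    and b: "b \<in> S n" "D n (x n) b < r" and "n \<le> m"
  shows "\<exists>y\<in>threads. y n = b \<and> D m (x m) (y m) < r"
  using \<open>n \<le> m\<close>
proof (induction m rule: dec_induct)
  case base
  then show ?case using thread_through b by blast
next
  case (step m)
  then obtain y where y: "y \<in> threads" "y n = b" "D m (x m) (y m) < r" by blast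
  then obtain c where c: "c \<in> S (Suc m)" "p m c = y m" "D (Suc m) (s (x m)) c < r"
    using lift x(1) thread_in by meson
  then obtain z where z: "z \<in> threads" "z (Suc m) = c" using thread_through by blast
  then have "z m = y m" using c thread_step by metis
  then have "z n = b" using threads_agree_below z(1) y(1,2) step.hyps(1) by metis
  then show ?case using z c x(2) step.hyps(1) by auto
qed

text \<open>Along a set \<open>C\<close> over which no fibre is mixed, \<open>P\<close> descends to a predicate \<open>Q\<close> on \<open>C\<close>. It is
  locally constant at \<open>a\<close>: near the thread through \<open>a\<close> along the section \<open>P\<close> does not change, and
  that neighbourhood meets the fibres of all points near \<open>a\<close>.\<close>

lemma thread_predicate_constant_over_connected:
  assumes P: "\<And>x. x \<in> threads \<Longrightarrow>
      \<exists>n W. openin (distance_topology (S n) (D n)) W \<and> x n \<in> W \<and> (\<forall>y\<in>threads. y n \<in> W \<longrightarrow> P y = P x)"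
    and C: "C \<subseteq> S n" "connected_space (distance_topology C (D n))"
    and fibres: "\<And>x y. x \<in> threads \<Longrightarrow> y \<in> threads \<Longrightarrow> x n \<in> C \<Longrightarrow> x n = y n \<Longrightarrow> P x = P y"
    and "x \<in> threads" "y \<in> threads" "x n \<in> C" "y n \<in> C" "P x"
  shows "P y"
proof -
  define Q where "Q a \<longleftrightarrow> (\<exists>x\<in>threads. x n = a \<and> P x)" for a
  have QP: "Q (x n) = P x" if "x \<in> threads" "x n \<in> C" for x
    using that fibres unfolding Q_def by metis
  have "\<exists>r>0. \<forall>b\<in>C. D n a b < r \<longrightarrow> Q b = Q a" if a: "a \<in> C" for a
  proof -
    obtain x where x: "x \<in> threads" "x n = a" "\<forall>k\<ge>n. x (Suc k) = s (x k)"
      using thread_along_section a C(1) by blast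
    \<comment> \<open>The stage \<open>k\<close> may lie below \<open>n\<close>, so the neighbourhood is moved up to stage \<open>max k n\<close>.\<close>
    obtain k W where W: "openin (distance_topology (S k) (D k)) W" "x k \<in> W"
      "\<forall>y\<in>threads. y k \<in> W \<longrightarrow> P y = P x"
      using P[OF x(1)] by blast
    obtain V where V: "openin (distance_topology (S (max k n)) (D (max k n))) V" "x (max k n) \<in> V"
      "\<forall>y\<in>threads. y (max k n) \<in> V \<longrightarrow> y k \<in> W"
      using nbhd_at_later_stage[OF x(1) W(1,2), of "max k n"] by auto
    then obtain r where r: "r > 0"
      "dball (S (max k n)) (D (max k n)) (x (max k n)) r \<subseteq> V"
      unfolding openin_distance_topology dopen_def by blast
    have "Q b = Q a" if b: "b \<in> C" "D n a b < r" for b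
    proof -
      obtain y where "y \<in> threads" "y n = b" "D (max k n) (x (max k n)) (y (max k n)) < r"
        using close_point_close_thread[OF x(1,3), of b r "max k n"] b x(2) C(1)
        by (metis max.cobounded2 subsetD)
      moreover from this have "y (max k n) \<in> V"
        using r(2) thread_in by (auto simp: dball_def)
      ultimately have "y \<in> threads" "y n = b" "P y = P x" using V W by auto
      then show ?thesis using QP[of x] QP[of y] x a b by auto
    qed
    then show ?thesis using r by blast
  qed
  then have "Q (y n)"
    using connected_distance_imp_locally_constant[OF C(2), of Q "x n" "y n"] QP assms by blast
  then show ?thesis using QP assms by blast
qed

text \<open>The threads form a connected space, expressed for a locally constant predicate \<open>P\<close>. A mixed point
  is one that lies on threads with both values of \<open>P\<close>. If \<open>P\<close> is not constant, mixed points can be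
  chosen one above the other; the thread they form contradicts the local constancy of \<open>P\<close>.\<close>

theorem locally_constant_on_threads:
  assumes P: "\<And>x. x \<in> threads \<Longrightarrow>
      \<exists>n W. openin (distance_topology (S n) (D n)) W \<and> x n \<in> W \<and> (\<forall>y\<in>threads. y n \<in> W \<longrightarrow> P y = P x)"
    and "x \<in> threads" "y \<in> threads" "P x"
  shows "P y"
proof (rule ccontr)
  assume "\<not> P y"
  define mixed where
    "mixed n a \<longleftrightarrow> (\<exists>x\<in>threads. \<exists>y\<in>threads. x n = a \<and> y n = a \<and> P x \<and> \<not> P y)" for n a
  have pure: "P x = P y" if "x \<in> threads" "y \<in> threads" "x n = y n" "\<not> mixed n (x n)" for x y n
    using that unfolding mixed_def by metis
  have "\<exists>a. mixed 0 a"
  proof (rule ccontr)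
    assume no: "\<nexists>a. mixed 0 a"
    have "P y"
    proof (rule thread_predicate_constant_over_connected[OF P order_refl base_connected, of x])
      show "P u = P v" if "u \<in> threads" "v \<in> threads" "u 0 = v 0" for u v
        using that no pure by metis
    qed (use assms thread_in in auto)
    then show False using \<open>\<not> P y\<close> by simp
  qed
  moreover have "\<exists>c. mixed (Suc n) c \<and> p n c = a" if a: "mixed n a" for n a
  proof (rule ccontr)
    assume no: "\<nexists>c. mixed (Suc n) c \<and> p n c = a"
    obtain u v where uv: "u \<in> threads" "v \<in> threads" "u n = a" "v n = a" "P u" "\<not> P v"
      using a by (auto simp: mixed_def)
    let ?F = "{c \<in> S (Suc n). p n c = a}"
    have "P v"
    proof (rule thread_predicate_constant_over_connected[OF P, of ?F "Suc n" u])
      show "connected_space (distance_topology ?F (D (Suc n)))"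
        using fibre_connected uv thread_in by blast
      show "P x = P y" if "x \<in> threads" "y \<in> threads" "x (Suc n) \<in> ?F" "x (Suc n) = y (Suc n)" for x y
        using that no pure by (metis (mono_tags, lifting) mem_Collect_eq)
    qed (use uv thread_in thread_step in auto)
    then show False using uv by simp
  qed
  ultimately obtain z where z: "\<And>n. mixed n (z n)" "\<And>n. p n (z (Suc n)) = z n"
    using dependent_nat_choice[of mixed "\<lambda>n a b. p n b = a"] by metis
  have "z n \<in> S n" for n
    using z(1)[of n] thread_in unfolding mixed_def by metis
  then have zt: "z \<in> threads"
    using z(2) by (simp add: threads_def)
  \<comment> \<open>A condition on a single coordinate \<open>z n\<close> already determines \<open>P\<close>.\<close>
  from P[OF zt] obtain n W where W: "z n \<in> W" "\<forall>y\<in>threads. y n \<in> W \<longrightarrow> P y = P z"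
    by (elim exE conjE)
  obtain u v where "u \<in> threads" "v \<in> threads" "u n = z n" "v n = z n" "P u" "\<not> P v"
    using z(1)[of n] unfolding mixed_def by blast
  then show False
    using W by simp
qed

end

section \<open>Distances in the complete oriented graph\<close>

lemma Vtx_in_cgraph: "Vtx a \<in> cgraph X \<longleftrightarrow> a \<in> X"
  by (auto simp: cgraph_def edge_def)

lemma Pt_in_cgraph: "Pt a b t \<in> cgraph X \<longleftrightarrow> a \<in> X \<and> b \<in> X \<and> a \<noteq> b \<and> 0 < t \<and> t < 1"
  by (auto simp: cgraph_def edge_def)

lemma cgraph_cases:
  assumes "z \<in> cgraph X"
  obtains a where "z = Vtx a" "a \<in> X"
  | a b t where "z = Pt a b t" "a \<in> X" "b \<in> X" "a \<noteq> b" "0 < t" "t < 1"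
  using assms by (auto simp: cgraph_def edge_def)

lemma graph_dist_le_edge_dist:
  assumes "on_common_edge X p q"
  shows "graph_dist X p q \<le> edge_dist p q"
proof -
  have "p \<in> cgraph X" "q \<in> cgraph X"
    using assms by (auto simp: on_common_edge_def cgraph_def)
  then show ?thesis
    using cInf_lower[OF chain_lengths_single[OF assms] bdd_below_chain_lengths]
    by (simp add: graph_dist_def)
qed

lemma graph_dist_same_edge_le:
  assumes "a \<in> X" "b \<in> X" "a \<noteq> b" "0 < t" "t < 1"
  shows "0 < s \<Longrightarrow> s < 1 \<Longrightarrow> graph_dist X (Pt a b t) (Pt a b s) \<le> \<bar>t - s\<bar>"
    and "graph_dist X (Vtx a) (Pt a b t) \<le> t"
    and "graph_dist X (Vtx b) (Pt a b t) \<le> 1 - t"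
    and "graph_dist X (Pt a b t) (Vtx a) \<le> t"
    and "graph_dist X (Pt a b t) (Vtx b) \<le> 1 - t"
  using assms graph_dist_le_edge_dist[of X "Pt a b t" "Pt a b s"]
    graph_dist_le_edge_dist[of X "Vtx a" "Pt a b t"] graph_dist_le_edge_dist[of X "Vtx b" "Pt a b t"]
    graph_dist_le_edge_dist[of X "Pt a b t" "Vtx a"] graph_dist_le_edge_dist[of X "Pt a b t" "Vtx b"]
  by (auto simp: on_common_edge_def edge_def)

lemma graph_dist_commute: "graph_dist X p q = graph_dist X q p"
  using Metric_space_graph_dist by (rule Metric_space.commute)

text \<open>Each function \<open>from_vtx a\<close> is 1-Lipschitz. On an edge starting at \<open>a\<close> it is the coordinate, so
  it transfers convergence questions to the real line.\<close>

lemma from_vtx_diff_le_graph_dist: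
  assumes "p \<in> cgraph X" "q \<in> cgraph X"
  shows "\<bar>from_vtx a p - from_vtx a q\<bar> \<le> graph_dist X p q"
  using graph_dist_ge[OF assms from_vtx_lipschitz[of X _ _ a]]
    graph_dist_ge[OF assms(2,1) from_vtx_lipschitz[of X _ _ a]] graph_dist_commute[of X p q]
  by linarith

lemma from_vtx_le_graph_dist:
  assumes "a \<in> X" "z \<in> cgraph X"
  shows "from_vtx a z \<le> graph_dist X (Vtx a) z"
  using from_vtx_diff_le_graph_dist[of "Vtx a" X z a] assms by (simp add: Vtx_in_cgraph)

lemma graph_dist_eq_from_vtx:
  assumes "a \<in> X" "z \<in> cgraph X" "from_vtx a z < 1"
  shows "graph_dist X (Vtx a) z = from_vtx a z"
proof (rule antisym[OF _ from_vtx_le_graph_dist[OF assms(1,2)]])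
  show "graph_dist X (Vtx a) z \<le> from_vtx a z"
    using assms(2)
  proof (cases rule: cgraph_cases)
    case (1 b)
    then have "z = Vtx a" using assms(3) by (auto split: if_splits)
    moreover have "graph_dist X (Vtx a) (Vtx a) = 0"
      using Metric_space.zero[OF Metric_space_graph_dist] assms(1) by (metis Vtx_in_cgraph)
    ultimately show ?thesis by simp
  next
    case (2 b c t)
    then show ?thesis
      using assms(3) graph_dist_same_edge_le[of b X c t] by (auto split: if_splits)
  qed
qed

text \<open>A point can be left from its edge only through an endpoint, and the nearer endpoint is at
  distance \<open>min t (1 - t)\<close>.\<close>

lemma near_edge_point:
  assumes "Pt a b t \<in> cgraph X" "z \<in> cgraph X" "graph_dist X (Pt a b t) z < min t (1 - t)"
  obtains s where "z = Pt a b s"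
proof -
  have t: "0 < t" "t < 1" using assms(1) by (auto simp: Pt_in_cgraph)
  have "from_pt a b t z \<le> graph_dist X (Pt a b t) z"
    using graph_dist_ge[OF assms(1,2) from_pt_lipschitz[of X _ _ t a b]] t by simp
  then have "from_pt a b t z < min t (1 - t)" using assms(3) by linarith
  then show ?thesis
    using that by (cases z) (auto split: if_splits)
qed

section \<open>Points of the cobweb and the compression map\<close>

text \<open>The bound on \<open>t\<close> is \<open>1 - d\<^sub>1(b,a)\<close>: the segment ends close to \<open>b\<close> exactly if \<open>d b a\<close> is small.\<close>

lemma cob_part_eq:
  assumes "distance_space X d" "a \<in> X"
  shows "cob_part X d a = {Vtx a} \<union>
    {Pt a b t |b t. b \<in> X \<and> b \<noteq> a \<and> 0 < t \<and> t < 1 \<and> t \<le> 1 - min (d b a) (1/2)}"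
proof -
  have seg: "cob_segment X d a b = {Vtx a} \<union> (if d b a = 0 then {Vtx b} else {}) \<union>
      {Pt a b t |t. 0 < t \<and> t < 1 \<and> t \<le> 1 - min (d b a) (1/2)}" if "b \<in> X - {a}" for b
    using that assms by (intro cob_segment_eq) (auto simp: distance_space_def)
  have "cob_part X d a = {Vtx a} \<union> (\<Union>b \<in> X - {a}. ({Vtx a} \<union> (if d b a = 0 then {Vtx b} else {}) \<union>
      {Pt a b t |t. 0 < t \<and> t < 1 \<and> t \<le> 1 - min (d b a) (1/2)}) - {Vtx b})"
    unfolding cob_part_def using seg by (intro arg_cong2[of _ _ _ _ "(\<union>)"] refl SUP_cong) auto
  then show ?thesis
    by (auto split: if_splits)
qed

lemma Vtx_in_cobweb: "distance_space X d \<Longrightarrow> Vtx a \<in> cobweb X d \<longleftrightarrow> a \<in> X"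
  by (auto simp: cobweb_def cob_part_eq)

lemma Pt_in_cobweb:
  "distance_space X d \<Longrightarrow> Pt a b t \<in> cobweb X d \<longleftrightarrow>
    a \<in> X \<and> b \<in> X \<and> b \<noteq> a \<and> 0 < t \<and> t < 1 \<and> t \<le> 1 - min (d b a) (1/2)"
  by (auto simp: cobweb_def cob_part_eq)

lemma cobweb_cases:
  assumes "distance_space X d" "z \<in> cobweb X d"
  obtains a where "z = Vtx a" "a \<in> X"
  | a b t where "z = Pt a b t" "a \<in> X" "b \<in> X" "b \<noteq> a" "0 < t" "t < 1" "t \<le> 1 - min (d b a) (1/2)"
  using assms by (auto simp: cobweb_def cob_part_eq)

lemma compression_Vtx: "a \<in> X \<Longrightarrow> compression X d (Vtx a) = a"
  by (rule compression_eq) (auto simp: cob_part_def)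

lemma compression_Pt:
  assumes "distance_space X d" "Pt a b t \<in> cobweb X d"
  shows "compression X d (Pt a b t) = a"
proof (rule compression_eq)
  show "a \<in> X" "Pt a b t \<in> cob_part X d a"
    using assms by (auto simp: Pt_in_cobweb cob_part_eq)
qed

lemma compression_in:
  assumes "z \<in> cobweb X d"
  shows "compression X d z \<in> X" "z \<in> cob_part X d (compression X d z)"
  using assms compression_eq[of _ X z d] by (auto simp: cobweb_def)

lemma compression_fibre: "a \<in> X \<Longrightarrow> {z \<in> cobweb X d. compression X d z = a} = cob_part X d a"
  using compression_in compression_eq by (fastforce simp: cobweb_def)

text \<open>Inside an edge the compression map is locally constant. A point near the vertex \<open>a\<close> that lies in
  the part over \<open>b \<noteq> a\<close> is on the edge from \<open>b\<close> to \<open>a\<close>, and it is there only because \<open>d\<^sub>1(a,b)\<close> does not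
  exceed its distance from \<open>a\<close>. Radii below \<open>1/2\<close> turn this into a bound on \<open>d a b\<close>, since
  \<open>d\<^sub>1 = min d (1/2)\<close>.\<close>

lemma compression_continuous:
  assumes X: "distance_space X d"
  shows "continuous_map (distance_topology (cobweb X d) (graph_dist X)) (distance_topology X d)
    (compression X d)"
proof (rule continuous_map_distance_topology)
  show "compression X d z \<in> X" if "z \<in> cobweb X d" for z
    using compression_in that by blast
  fix z and e :: real assume z: "z \<in> cobweb X d" and e: "e > 0"
  have d0: "d a a = 0" if "a \<in> X" for a
    using X that by (simp add: distance_space_def)
  have cg: "w \<in> cgraph X" if "w \<in> cobweb X d" for w
    using that cobweb_subset by blast
  from X z show "\<exists>r>0. \<forall>w\<in>cobweb X d. graph_dist X z w < r \<longrightarrow>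
      d (compression X d z) (compression X d w) < e"
  proof (cases rule: cobweb_cases)
    case (1 a)
    have "d a (compression X d w) < e"
      if w: "w \<in> cobweb X d" "graph_dist X z w < min e (1/2)" for w
    proof -
      have fw: "from_vtx a w < min e (1/2)"
        using from_vtx_le_graph_dist[of a X w] w 1 cg by fastforce
      from X w(1) show ?thesis
      proof (cases rule: cobweb_cases)
        case (1 b)
        then show ?thesis
          using fw e d0 by (auto simp: compression_Vtx split: if_splits)
      next
        case (2 b c t)
        then show ?thesis
          using fw e d0[of a] compression_Pt[OF X, of b c t] w(1)
          by (auto simp: min_def split: if_splits)
      qed
    qed
    then show ?thesis
      using 1 e by (intro exI[of _ "min e (1/2)"]) (auto simp: compression_Vtx)
  next
    case (2 a b t)
    have "compression X d w = a" if w: "w \<in> cobweb X d" "graph_dist X z w < min t (1 - t)" for w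
      using near_edge_point[of a b t X w] w z 2 cg compression_Pt[OF X] by metis
    moreover have "compression X d z = a" using 2 z compression_Pt[OF X] by blast
    ultimately show ?thesis
      using 2 e d0 by (intro exI[of _ "min t (1 - t)"]) auto
  qed
qed

text \<open>The edge segment from \<open>b\<close> towards \<open>a\<close> ends at distance \<open>d\<^sub>1(a,b)\<close> from \<open>a\<close>, which is below \<open>r\<close>. If
  \<open>d a b = 0\<close>, the segment comes arbitrarily close to \<open>a\<close> but does not contain it.\<close>

lemma cobweb_lift:
  assumes X: "distance_space X d" and ab: "a \<in> X" "b \<in> X" "d a b < r"
  shows "\<exists>c\<in>cobweb X d. compression X d c = b \<and> graph_dist X (Vtx a) c < r"
proof (cases "a = b")
  case True
  moreover have "graph_dist X (Vtx a) (Vtx a) = 0"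
    using Metric_space.zero[OF Metric_space_graph_dist] ab(1) by (metis Vtx_in_cgraph)
  ultimately show ?thesis
    using ab X by (intro bexI[of _ "Vtx a"]) (auto simp: compression_Vtx Vtx_in_cobweb distance_space_def)
next
  case False
  \<comment> \<open>The second argument of \<open>max\<close> keeps \<open>e\<close> positive if \<open>d a b = 0\<close>.\<close>
  define e where "e = max (min (d a b) (1/2)) (min (r/2) (1/2))"
  have "0 \<le> d a b" using X ab by (simp add: distance_space_def)
  then have e: "0 < e" "e < r" "e \<le> 1/2" "min (d a b) (1/2) \<le> e"
    using ab(3) by (auto simp: e_def)
  then have mem: "Pt b a (1 - e) \<in> cobweb X d"
    using X ab False by (simp add: Pt_in_cobweb)
  moreover have "graph_dist X (Vtx a) (Pt b a (1 - e)) \<le> e"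
    using graph_dist_same_edge_le(3)[of b X a "1 - e"] ab False e by simp
  ultimately show ?thesis
    using compression_Pt[OF X mem] e by (intro bexI[of _ "Pt b a (1 - e)"]) auto
qed

text \<open>The part over \<open>a\<close> is a union of arcs, parametrised by the distance from their common end \<open>a\<close>.\<close>

lemma cob_part_connected:
  assumes X: "distance_space X d" and a: "a \<in> X"
  shows "connected_space (distance_topology (cob_part X d a) (graph_dist X))" (is "connected_space ?T")
proof -
  have top: "topspace ?T = cob_part X d a" by (rule topspace_distance_topology)
  have arm: "\<exists>A. connectedin ?T A \<and> Vtx a \<in> A \<and> z \<in> A" if z: "z \<in> cob_part X d a" for z
  proof -
    consider "z = Vtx a" | b t where "z = Pt a b t" "b \<in> X" "b \<noteq> a" "0 < t" "t < 1"
        "t \<le> 1 - min (d b a) (1/2)"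
      using z cob_part_eq[OF X a] by auto
    then show ?thesis
    proof cases
      case 1
      then show ?thesis
        using z top by (intro exI[of _ "{z}"]) (simp add: connectedin_sing)
    next
      case (2 b t)
      define g where "g u = (if u = 0 then Vtx a else Pt a b u)" for u
      have g_in: "g u \<in> cob_part X d a" if "u \<in> {0..t}" for u
        using that 2 by (auto simp: g_def cob_part_eq[OF X a])
      have lip: "graph_dist X (g u) (g v) \<le> \<bar>u - v\<bar>" if "u \<in> {0..t}" "v \<in> {0..t}" for u v
      proof -
        have "graph_dist X (Vtx a) (Vtx a) = 0"
          using Metric_space.zero[OF Metric_space_graph_dist] a by (metis Vtx_in_cgraph)
        then show ?thesis
          using that 2 a graph_dist_same_edge_le[of a X b u] graph_dist_same_edge_le[of a X b v]
          by (auto simp: g_def)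
      qed
      have "continuous_map (top_of_set {0..t}) ?T g"
        unfolding continuous_map_def top openin_distance_topology
      proof (intro conjI allI impI)
        show "g \<in> topspace (top_of_set {0..t}) \<rightarrow> cob_part X d a" using g_in by auto
        fix E assume E: "dopen (cob_part X d a) (graph_dist X) E"
        have "\<exists>r>0. \<forall>v\<in>{0..t}. dist v u < r \<longrightarrow> v \<in> {v \<in> {0..t}. g v \<in> E}"
          if u: "u \<in> {0..t}" "g u \<in> E" for u
        proof -
          obtain r where r: "r > 0" "dball (cob_part X d a) (graph_dist X) (g u) r \<subseteq> E"
            using E u(2) by (auto simp: dopen_def)
          have "g v \<in> E" if "v \<in> {0..t}" "dist v u < r" for v
            using lip[OF u(1) that(1)] that r(2) g_in[OF that(1)]
            by (auto simp: dball_def dist_real_def abs_minus_commute)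
          then show ?thesis using r(1) by blast
        qed
        then show "openin (top_of_set {0..t}) {u \<in> topspace (top_of_set {0..t}). g u \<in> E}"
          by (auto simp: openin_euclidean_subtopology_iff)
      qed
      moreover have "connectedin (top_of_set {0..t}) {0..t}"
        by (simp add: connectedin_subtopology)
      ultimately have "connectedin ?T (g ` {0..t})"
        by (rule connectedin_continuous_map_image)
      moreover have "Vtx a = g 0" "z = g t" using 2 by (auto simp: g_def)
      ultimately show ?thesis using 2
        by (intro exI[of _ "g ` {0..t}"]) auto
    qed
  qed
  show ?thesis
    unfolding connected_space_subconnected top
  proof (intro ballI)
    fix z w assume "z \<in> cob_part X d a" "w \<in> cob_part X d a"
    then obtain A B where "connectedin ?T A" "Vtx a \<in> A" "z \<in> A" "connectedin ?T B" "Vtx a \<in> B" "w \<in> B"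
      using arm by meson
    then have "connectedin ?T (A \<union> B)" "z \<in> A \<union> B" "w \<in> A \<union> B"
      by (auto intro!: connectedin_Un)
    then show "\<exists>S. connectedin ?T S \<and> z \<in> S \<and> w \<in> S"
      by blast
  qed
qed

section \<open>Completeness of the cobweb\<close>

lemma Metric_space_cobweb: "Metric_space (cobweb X d) (graph_dist X)"
  using Metric_space.subspace[OF Metric_space_graph_dist cobweb_subset] .

text \<open>A Cauchy sequence \<open>f\<close> eventually stays in the open star of a vertex \<open>a\<close>. Its distances from \<open>a\<close>
  converge to some \<open>L\<close>. If \<open>L = 0\<close>, the limit is \<open>a\<close>. If \<open>L > 0\<close>, the sequence eventually stays away
  from all vertices, hence on a single edge, where it converges like its coordinate; the limit is
  in the cobweb since the segments are cut off by a weak inequality.\<close>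

lemma mcomplete_cobweb:
  assumes X: "distance_space X d"
  shows "Metric_space.mcomplete (cobweb X d) (graph_dist X)"
proof -
  interpret M: Metric_space "cobweb X d" "graph_dist X" by (rule Metric_space_cobweb)
  show ?thesis
    unfolding M.mcomplete_def
  proof (intro allI impI)
    fix f assume f: "M.MCauchy f"
    have f_in: "f n \<in> cobweb X d" for n using f by (auto simp: M.MCauchy_def)
    then have f_cg: "f n \<in> cgraph X" for n using cobweb_subset by blast
    have cau: "\<exists>N. \<forall>n\<ge>N. \<forall>m\<ge>N. graph_dist X (f n) (f m) < e" if "e > 0" for e
      using f that by (meson M.MCauchy_def)
    have "Cauchy (\<lambda>n. from_vtx a (f n))" for a
      unfolding Cauchy_def dist_real_def
      using cau from_vtx_diff_le_graph_dist[OF f_cg f_cg, of a] by (meson le_less_trans)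
    then have conv: "convergent (\<lambda>n. from_vtx a (f n))" for a
      by (rule Cauchy_convergent)
    obtain N where N: "\<And>n m. n \<ge> N \<Longrightarrow> m \<ge> N \<Longrightarrow> graph_dist X (f n) (f m) < 1/4"
      using cau[of "1/4"] by auto
    obtain a where a: "a \<in> X" "from_vtx a (f N) \<le> 1/2"
      using f_cg[of N]
    proof (cases rule: cgraph_cases)
      case (1 a)
      then show ?thesis using that[of a] by simp
    next
      case (2 a b t)
      then show ?thesis
        using that[of a] that[of b] by (cases "t \<le> 1/2") auto
    qed
    have star: "from_vtx a (f n) < 3/4" if "n \<ge> N" for n
      using from_vtx_diff_le_graph_dist[OF f_cg f_cg, of a n N] N[OF that order_refl] a(2) by linarith
    obtain L where L: "(\<lambda>n. from_vtx a (f n)) \<longlonglongrightarrow> L"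
      using conv by (auto simp: convergent_def)
    have "0 \<le> from_vtx a (f n)" for n
      using f_cg[of n] by (cases rule: cgraph_cases) auto
    then have "0 \<le> L" by (intro LIMSEQ_le_const[OF L]) auto
    then consider "L = 0" | "L > 0" by linarith
    then show "\<exists>x. limitin M.mtopology f x sequentially"
    proof cases
      case 1
      have "\<exists>K. \<forall>n\<ge>K. f n \<in> cobweb X d \<and> graph_dist X (f n) (Vtx a) < e" if e: "e > 0" for e
      proof -
        obtain K where "\<And>n. n \<ge> K \<Longrightarrow> from_vtx a (f n) < e"
          using order_tendstoD(2)[OF L[unfolded 1] e] by (auto simp: eventually_sequentially)
        moreover have "graph_dist X (f n) (Vtx a) = from_vtx a (f n)" if "n \<ge> N" for n
          using graph_dist_eq_from_vtx[OF a(1) f_cg] star[OF that] by (simp add: graph_dist_commute)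
        ultimately show ?thesis
          using f_in by (intro exI[of _ "max K N"]) auto
      qed
      then have "limitin M.mtopology f (Vtx a) sequentially"
        using a X by (simp add: M.limit_metric_sequentially Vtx_in_cobweb)
      then show ?thesis by blast
    next
      case 2
      \<comment> \<open>Eventually all distances from \<open>a\<close> are between \<open>L/2\<close> and \<open>3/4\<close>, so those from both endpoints of
        the edge exceed \<open>\<delta>\<close>.\<close>
      define \<delta> where "\<delta> = min (L/2) (1/4)"
      have \<delta>: "0 < \<delta>" using 2 by (simp add: \<delta>_def)
      obtain K1 where K1: "\<And>n. n \<ge> K1 \<Longrightarrow> L/2 < from_vtx a (f n)"
        using order_tendstoD(1)[OF L, of "L/2"] 2 by (auto simp: eventually_sequentially)
      obtain K2 where K2: "\<And>n m. n \<ge> K2 \<Longrightarrow> m \<ge> K2 \<Longrightarrow> graph_dist X (f n) (f m) < \<delta>"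
        using cau[OF \<delta>] by auto
      define K where "K = max N (max K1 K2)"
      have K_ge: "K2 \<le> K" by (simp add: K_def)
      have bnd: "\<delta> < from_vtx a (f n)" "from_vtx a (f n) < 1 - \<delta>" if "n \<ge> K" for n
        using K1[of n] star[of n] that by (auto simp: K_def \<delta>_def)
      obtain b c t where K: "f K = Pt b c t" "a = b \<or> a = c"
        using f_cg[of K]
      proof (cases rule: cgraph_cases)
        case (1 b)
        then show ?thesis using bnd[of K] \<delta> by (auto split: if_splits)
      next
        case (2 b c t)
        then show ?thesis using that[of b c t] bnd[of K] \<delta> by (auto split: if_splits)
      qed
      have bc: "b \<in> X" "c \<in> X" "b \<noteq> c"
        using f_cg[of K] K by (auto simp: Pt_in_cgraph)
      have t: "\<delta> < t" "t < 1 - \<delta>"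
        using bnd[of K] K bc by (auto split: if_splits)
      have "\<exists>s. f n = Pt b c s" if "n \<ge> K" for n
      proof -
        have "graph_dist X (Pt b c t) (f n) < min t (1 - t)"
          using K2[OF K_ge order_trans[OF K_ge that]] t K by simp
        then show ?thesis
          using near_edge_point[of b c t X "f n"] f_cg K by metis
      qed
      then obtain s where s: "\<And>n. n \<ge> K \<Longrightarrow> f n = Pt b c (s n)" by metis
      obtain u where u: "(\<lambda>n. from_vtx b (f n)) \<longlonglongrightarrow> u"
        using conv by (auto simp: convergent_def)
      have s_eq: "from_vtx b (f n) = s n" if "n \<ge> K" for n
        using s[OF that] by simp
      have s_bnd: "\<delta> \<le> s n" "s n \<le> 1 - \<delta>" "s n \<le> 1 - min (d c b) (1/2)" if "n \<ge> K" for n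
        using bnd[OF that] s[OF that] K(2) bc f_in[of n] X
        by (auto simp: Pt_in_cobweb split: if_splits)
      have "\<delta> \<le> u"
        using s_bnd(1) s_eq by (intro LIMSEQ_le_const[OF u]) (auto intro!: exI[of _ K])
      moreover have "u \<le> 1 - \<delta>"
        using s_bnd(2) s_eq by (intro LIMSEQ_le_const2[OF u]) (auto intro!: exI[of _ K])
      moreover have "u \<le> 1 - min (d c b) (1/2)"
        by (intro LIMSEQ_le_const2[OF u] exI[of _ K]) (use s_bnd(3) s_eq in metis)
      ultimately have u_in: "0 < u" "u < 1" "Pt b c u \<in> cobweb X d"
        using \<delta> bc X by (auto simp: Pt_in_cobweb)
      have "\<exists>K. \<forall>n\<ge>K. f n \<in> cobweb X d \<and> graph_dist X (f n) (Pt b c u) < e" if e: "e > 0" for e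
      proof -
        obtain K3 where K3: "\<And>n. n \<ge> K3 \<Longrightarrow> \<bar>from_vtx b (f n) - u\<bar> < e"
          using LIMSEQ_D[OF u e] by auto
        have "graph_dist X (f n) (Pt b c u) < e" if n: "n \<ge> max K K3" for n
        proof -
          have "n \<ge> K" "n \<ge> K3" using n by auto
          have "0 < s n" "s n < 1" using s_bnd[OF \<open>n \<ge> K\<close>] \<delta> by auto
          then have "graph_dist X (f n) (Pt b c u) \<le> \<bar>s n - u\<bar>"
            using graph_dist_same_edge_le(1)[of b X c "s n" u] s[OF \<open>n \<ge> K\<close>] bc u_in by simp
          then show ?thesis using K3[OF \<open>n \<ge> K3\<close>] s_eq[OF \<open>n \<ge> K\<close>] by simp
        qed
        then show ?thesis using f_in by blast
      qed
      then have "limitin M.mtopology f (Pt b c u) sequentially"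
        using u_in by (simp add: M.limit_metric_sequentially)
      then show ?thesis by blast
    qed
  qed
qed

section \<open>Separable connected subsets of the cobweb over a metric space\<close>

text \<open>The open segment of the edge from \<open>a\<close> to \<open>b\<close> that lies in the cobweb is open, and the only vertex
  in its closure is \<open>a\<close>: it keeps the distance \<open>d\<^sub>1(b,a)\<close> from \<open>b\<close>, which is positive as \<open>d\<close> is a metric.
  So it is clopen in any set that avoids \<open>a\<close>.\<close>

lemma connected_in_edge_of_missing_vertex:
  assumes M: "Metric_space X d"
    and C: "C \<subseteq> cobweb X d" "connected_space (distance_topology C (graph_dist X))"
    and "z \<in> C" "Vtx (compression X d z) \<notin> C" "w \<in> C"
  shows "compression X d w = compression X d z"
proof -
  interpret M: Metric_space X d by (rule M)
  note X = M.distance_space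
  have cg: "v \<in> cgraph X" if "v \<in> C" for v
    using that C(1) cobweb_subset by blast
  have zC: "z \<in> cobweb X d" using assms by blast
  from X zC obtain a b t where z: "z = Pt a b t" "a \<in> X" "b \<in> X" "b \<noteq> a"
  proof (cases rule: cobweb_cases)
    case (1 a)
    then show ?thesis using assms by (simp add: compression_Vtx)
  qed auto
  then have a: "compression X d z = a" "Vtx a \<notin> C"
    using compression_Pt[OF X] zC assms by auto
  have "\<exists>r>0. \<forall>w\<in>C. graph_dist X v w < r \<longrightarrow> (\<exists>s. w = Pt a b s) = (\<exists>s. v = Pt a b s)"
    if v: "v \<in> C" for v
  proof -
    have "v \<in> cobweb X d" using v C(1) by blast
    with X show ?thesis
    proof (cases rule: cobweb_cases)
      case (1 c)
      \<comment> \<open>The end of the edge at \<open>b\<close> has been cut off; any other vertex apart from \<open>a\<close>, which is not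
        in \<open>C\<close>, has distance at least \<open>1\<close>.\<close>
      have far: "min (d b a) (1/2) \<le> graph_dist X v (Pt a b s)" if "Pt a b s \<in> C" for s
      proof -
        have "Pt a b s \<in> cobweb X d" "Pt a b s \<in> cgraph X" using that C(1) cg by auto
        then show ?thesis
          using from_vtx_le_graph_dist[of c X "Pt a b s"] 1 v a X
          by (auto simp: Pt_in_cobweb split: if_splits)
      qed
      have "0 < min (d b a) (1/2)" using z M.mdist_pos_eq[of b a] by auto
      then show ?thesis
        using far 1 by (intro exI[of _ "min (d b a) (1/2)"]) force
    next
      case (2 a' b' t')
      have "\<exists>s. w = Pt a' b' s" if "w \<in> C" "graph_dist X v w < min t' (1 - t')" for w
        using near_edge_point[of a' b' t' X w] 2 that v cg by metis
      then show ?thesis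
        using 2 by (intro exI[of _ "min t' (1 - t')"]) fastforce
    qed
  qed
  then have "\<exists>s. w = Pt a b s"
    using connected_distance_imp_locally_constant[OF C(2), of "\<lambda>w. \<exists>s. w = Pt a b s" z w] assms z
    by blast
  then show ?thesis
    using compression_Pt[OF X] a(1) C(1) assms by auto
qed

text \<open>The balls of radius \<open>1/2\<close> around distinct vertices are disjoint, and each of those around a
  vertex in \<open>C\<close> contains a point of a countable dense set.\<close>

lemma countable_vertices_of_separable:
  assumes "C \<subseteq> cobweb X d" "separable_space (distance_topology C (graph_dist X))"
  shows "countable {a \<in> X. Vtx a \<in> C}"
proof -
  interpret M: Metric_space C "graph_dist X"
    using Metric_space.subspace[OF Metric_space_cobweb assms(1)] .
  obtain U where U: "countable U" "U \<subseteq> C" "M.mtopology closure_of U = C"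
    using assms(2) unfolding separable_space_def M.mtopology_eq_distance_topology[symmetric]
    by auto
  have sub: "C \<subseteq> cgraph X" using assms(1) cobweb_subset by blast
  define f where "f u = (SOME a. a \<in> X \<and> graph_dist X (Vtx a) u < 1/2)" for u
  have "a \<in> f ` U" if a: "a \<in> X" "Vtx a \<in> C" for a
  proof -
    have "Vtx a \<in> M.mtopology closure_of U" using U(3) a(2) by simp
    then have "\<forall>r>0. \<exists>u\<in>U. u \<in> M.mball (Vtx a) r"
      unfolding M.metric_closure_of by blast
    then obtain u where "u \<in> U" "u \<in> M.mball (Vtx a) (1/2)"
      by (meson half_gt_zero zero_less_one)
    then have u: "u \<in> U" "graph_dist X (Vtx a) u < 1/2" by simp_all
    have uniq: "b = a" if b: "b \<in> X" "graph_dist X (Vtx b) u < 1/2" for b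
    proof -
      have mem: "Vtx a \<in> cgraph X" "Vtx b \<in> cgraph X" "u \<in> cgraph X"
        using a(1) b(1) subsetD[OF sub subsetD[OF U(2) u(1)]] by (simp_all add: Vtx_in_cgraph)
      have "graph_dist X (Vtx a) (Vtx b) < 1"
        using Metric_space.triangle[OF Metric_space_graph_dist mem(1,3,2)] u b
          graph_dist_commute[of X u "Vtx b"] by linarith
      then show ?thesis
        using from_vtx_le_graph_dist[OF a(1) mem(2)] by (cases "b = a") simp_all
    qed
    have "f u = a"
      unfolding f_def by (rule some_equality) (use a(1) u(2) uniq in blast)+
    then show ?thesis using u by blast
  qed
  then have "{a \<in> X. Vtx a \<in> C} \<subseteq> f ` U" by blast
  then show ?thesis by (rule countable_subset[OF _ countable_image[OF U(1)]])
qed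

text \<open>Either \<open>C\<close> is trapped in an edge, or its image is a countable connected set in a metric space,
  hence a singleton.\<close>

lemma compression_constant_on_separable_connected:
  assumes M: "Metric_space X d"
    and con: "connectedin (distance_topology (cobweb X d) (graph_dist X)) C"
    and sep: "separable_space (subtopology (distance_topology (cobweb X d) (graph_dist X)) C)"
    and zw: "z \<in> C" "w \<in> C"
  shows "compression X d z = compression X d w"
proof -
  interpret M: Metric_space X d by (rule M)
  interpret W: Metric_space "cobweb X d" "graph_dist X" by (rule Metric_space_cobweb)
  have C: "C \<subseteq> cobweb X d"
    using connectedin_subset_topspace[OF con] by (simp add: topspace_distance_topology)
  note eq = W.subtopology_eq_distance_topology[OF C]
  have con': "connected_space (distance_topology C (graph_dist X))"
    using con by (simp add: connectedin_def eq)
  show ?thesis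
  proof (cases "\<forall>v\<in>C. Vtx (compression X d v) \<in> C")
    case False
    then obtain v where "v \<in> C" "Vtx (compression X d v) \<notin> C" by blast
    then show ?thesis
      using connected_in_edge_of_missing_vertex[OF M C con'] zw by metis
  next
    case True
    let ?Y = "subtopology (distance_topology X d) (compression X d ` C)"
    have "compression X d ` C \<subseteq> {a \<in> X. Vtx a \<in> C}"
      using True C compression_in(1) by blast
    then have count: "countable (compression X d ` C)" and sub: "compression X d ` C \<subseteq> X"
      using countable_vertices_of_separable[OF C] sep eq by (auto intro: countable_subset)
    have "connectedin (distance_topology X d) (compression X d ` C)"
      using connectedin_continuous_map_image[OF compression_continuous[OF M.distance_space] con] .
    then have "connected_space ?Y" by (simp add: connectedin_def)
    moreover have "regular_space ?Y" "Hausdorff_space ?Y"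
      using M.regular_space_mtopology M.Hausdorff_space_mtopology M.mtopology_eq_distance_topology
      by (simp_all add: regular_space_subtopology Hausdorff_space_subtopology)
    moreover have "topspace ?Y = compression X d ` C"
      using sub by (auto simp: topspace_distance_topology)
    ultimately obtain a where "compression X d ` C \<subseteq> {a}"
      using connected_space_imp_uncountable[of ?Y] count by auto
    then show ?thesis using zw by blast
  qed
qed

section \<open>The inverse limit of the iterated cobwebs\<close>

lemma distance_space_cob:
  assumes "distance_space X d"
  shows "distance_space (cob_set X d n) (cob_dist X d n)"
proof (cases n)
  case 0
  then show ?thesis using assms by (auto simp: distance_space_def)
next
  case (Suc m)
  then show ?thesis using Metric_space.distance_space[OF Metric_space_cob] by metis
qed

lemma cob_topology_eq_distance_topology:
  assumes "1 \<le> n"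
  shows "cob_topology X d n = distance_topology (cob_set X d n) (cob_dist X d n)"
proof -
  obtain m where n: "n = Suc m" using assms by (cases n) auto
  show ?thesis
    unfolding cob_topology_def n
    by (rule Metric_space.mtopology_eq_distance_topology[OF Metric_space_cob])
qed

lemma topspace_cob_topology: "1 \<le> n \<Longrightarrow> topspace (cob_topology X d n) = cob_set X d n"
  by (simp add: cob_topology_eq_distance_topology topspace_distance_topology)

lemma connected_space_Leaf_copy:
  assumes X: "distance_space X d" and con: "connected_space (distance_topology X d)"
  shows "connected_space (distance_topology (cob_set X d 0) (cob_dist X d 0))"
proof -
  have "continuous_map (distance_topology X d)
      (distance_topology (cob_set X d 0) (cob_dist X d 0)) Leaf"
    by (rule continuous_map_distance_topology) auto
  then have "connectedin (distance_topology (cob_set X d 0) (cob_dist X d 0)) (Leaf ` X)"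
    using con connectedin_continuous_map_image[of _ _ Leaf X]
    by (metis connectedin_topspace topspace_distance_topology)
  then show ?thesis
    by (metis cob_set.simps(1) connectedin_topspace topspace_distance_topology)
qed

text \<open>The hypothesis on \<open>(X,d)\<close> supplies the connected base, the parts \<open>cob_part\<close> of the cobwebs are
  the fibres, and the vertices form the section.\<close>

lemma lifting_sequence_cob:
  assumes X: "distance_space X d" and con: "connected_space (distance_topology X d)"
  shows "lifting_sequence (cob_set X d) (cob_dist X d)
    (\<lambda>n. compression (cob_set X d n) (cob_dist X d n)) Vtx"
proof
  fix n
  note dist = distance_space_cob[OF X, of n]
  show "continuous_map (distance_topology (cob_set X d (Suc n)) (cob_dist X d (Suc n)))
      (distance_topology (cob_set X d n) (cob_dist X d n)) (compression (cob_set X d n) (cob_dist X d n))"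
    using compression_continuous[OF dist] by simp
  fix a assume a: "a \<in> cob_set X d n"
  show "Vtx a \<in> cob_set X d (Suc n)"
    using a dist by (simp add: Vtx_in_cobweb)
  show "compression (cob_set X d n) (cob_dist X d n) (Vtx a) = a"
    using a by (rule compression_Vtx)
  show "connected_space (distance_topology
      {c \<in> cob_set X d (Suc n). compression (cob_set X d n) (cob_dist X d n) c = a} (cob_dist X d (Suc n)))"
    using cob_part_connected[OF dist a] by (simp add: compression_fibre[OF a])
  fix b r assume "b \<in> cob_set X d n" "cob_dist X d n a b < r"
  then show "\<exists>c\<in>cob_set X d (Suc n). compression (cob_set X d n) (cob_dist X d n) c = b \<and>
      cob_dist X d (Suc n) (Vtx a) c < r"
    using cobweb_lift[OF dist a] by simp
next
  show "connected_space (distance_topology (cob_set X d 0) (cob_dist X d 0))"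
    by (rule connected_space_Leaf_copy[OF X con])
qed

text \<open>Coordinate \<open>0\<close> lies outside the index set of the product, so it has the default value of an
  extensional function.\<close>

lemma cob_limit_set_iff:
  "x \<in> cob_limit_set X d \<longleftrightarrow> x 0 = undefined \<and>
    (\<forall>n\<ge>1. x n \<in> cob_set X d n \<and> compression (cob_set X d n) (cob_dist X d n) (x (Suc n)) = x n)"
proof -
  have "x \<in> extensional {1..} \<longleftrightarrow> x 0 = undefined"
    unfolding extensional_def by (simp add: not_le)
  then show ?thesis
    unfolding cob_limit_set_def PiE_iff by auto
qed

lemma topspace_cob_limit: "topspace (cob_limit X d) = cob_limit_set X d"
proof -
  have "cob_limit_set X d \<subseteq> (\<Pi>\<^sub>E n\<in>{1..}. topspace (cob_topology X d n))"
    by (auto simp: cob_limit_set_def topspace_cob_topology intro!: PiE_I dest: PiE_mem PiE_arb)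
  then show ?thesis by (auto simp: cob_limit_def)
qed

text \<open>Threads that start at stage \<open>0\<close> correspond to the points of the limit, whose coordinates start at
  stage \<open>1\<close>: the coordinate at stage \<open>0\<close> is determined by the next one. A separation of the limit
  becomes a locally constant predicate on threads.\<close>

lemma connected_cob_limit:
  assumes X: "distance_space X d" and con: "connected_space (distance_topology X d)"
  shows "connected_space (cob_limit X d)"
proof -
  interpret L: lifting_sequence "cob_set X d" "cob_dist X d"
    "\<lambda>n. compression (cob_set X d n) (cob_dist X d n)" Vtx
    by (rule lifting_sequence_cob[OF X con])
  have in_limit: "restrict x {1..} \<in> cob_limit_set X d" if "x \<in> L.threads" for x
    using L.thread_in[OF that] L.thread_step[OF that] by (simp add: cob_limit_set_iff)
  have from_limit: "\<exists>x\<in>L.threads. restrict x {1..} = y" if y: "y \<in> cob_limit_set X d" for y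
  proof -
    define x where "x = y(0 := compression (cob_set X d 0) (cob_dist X d 0) (y 1))"
    have "y 1 \<in> cob_set X d 1" using y unfolding cob_limit_set_iff by blast
    then have "compression (cob_set X d 0) (cob_dist X d 0) (y 1) \<in> cob_set X d 0"
      by (metis One_nat_def cob_set.simps(2) compression_in(1))
    then have "x \<in> L.threads"
      using y by (simp add: x_def L.threads_def cob_limit_set_iff Suc_le_eq)
    moreover have "restrict x {1..} = y"
      using y by (auto simp: x_def cob_limit_set_iff fun_eq_iff Suc_le_eq)
    ultimately show ?thesis by blast
  qed
  have nbhd: "\<exists>n W. openin (distance_topology (cob_set X d n) (cob_dist X d n)) W \<and> x n \<in> W \<and>
      (\<forall>y\<in>L.threads. y n \<in> W \<longrightarrow> restrict y {1..} \<in> U)"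
    if U: "openin (cob_limit X d) U" and x: "x \<in> L.threads" "restrict x {1..} \<in> U" for U x
  proof -
    obtain O' where O': "openin (product_topology (cob_topology X d) {1..}) O'"
      "U = O' \<inter> cob_limit_set X d"
      using U by (auto simp: cob_limit_def openin_subtopology)
    then have "restrict x {1..} \<in> O'" using x by auto
    then have "\<exists>F. finite {i \<in> {1..}. F i \<noteq> topspace (cob_topology X d i)} \<and>
        (\<forall>i\<in>{1..}. openin (cob_topology X d i) (F i)) \<and> restrict x {1..} \<in> Pi\<^sub>E {1..} F \<and> Pi\<^sub>E {1..} F \<subseteq> O'"
      using O'(1) unfolding openin_product_topology_alt by (rule bspec[rotated])
    then obtain F where F: "finite {i \<in> {1..}. F i \<noteq> topspace (cob_topology X d i)}"
      "\<And>i. 1 \<le> i \<Longrightarrow> openin (cob_topology X d i) (F i)"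
      "restrict x {1..} \<in> Pi\<^sub>E {1..} F" "Pi\<^sub>E {1..} F \<subseteq> O'"
      by (elim exE conjE) (simp add: Ball_def)
    define J where "J = {i \<in> {1..}. F i \<noteq> topspace (cob_topology X d i)}"
    have "openin (distance_topology (cob_set X d i) (cob_dist X d i)) (F i) \<and> x i \<in> F i" if "i \<in> J" for i
    proof -
      have i: "1 \<le> i" using that by (simp add: J_def)
      then show ?thesis
        using F(2)[OF i] PiE_mem[OF F(3), of i] by (simp add: cob_topology_eq_distance_topology)
    qed
    then obtain n W where W: "openin (distance_topology (cob_set X d n) (cob_dist X d n)) W" "x n \<in> W"
      "\<forall>y\<in>L.threads. y n \<in> W \<longrightarrow> (\<forall>i\<in>J. y i \<in> F i)"
      using L.finite_nbhds_at_one_stage[OF x(1), of J F] F(1) unfolding J_def by blast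
    have "restrict y {1..} \<in> U" if y: "y \<in> L.threads" "y n \<in> W" for y
    proof -
      have "y i \<in> F i" if i: "1 \<le> i" for i
      proof (cases "i \<in> J")
        case True
        then show ?thesis using W(3) y by blast
      next
        case False
        then have "F i = cob_set X d i" using i by (simp add: J_def topspace_cob_topology)
        then show ?thesis using L.thread_in[OF y(1), of i] by simp
      qed
      then have "restrict y {1..} \<in> Pi\<^sub>E {1..} F" by auto
      then show ?thesis using F(4) O'(2) in_limit[OF y(1)] by blast
    qed
    then show ?thesis using W(1,2) by blast
  qed
  show ?thesis
    unfolding connected_space_def
  proof (rule notI, elim exE conjE)
    fix U V
    assume U: "openin (cob_limit X d) U" and V: "openin (cob_limit X d) V"
      and cover: "topspace (cob_limit X d) \<subseteq> U \<union> V" and disj: "U \<inter> V = {}"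
      and ne: "U \<noteq> {}" "V \<noteq> {}"
    have sub: "U \<subseteq> cob_limit_set X d" "V \<subseteq> cob_limit_set X d"
      using openin_subset[OF U] openin_subset[OF V] by (simp_all add: topspace_cob_limit)
    obtain x where x: "x \<in> L.threads" "restrict x {1..} \<in> U"
      using ne(1) sub(1) from_limit by blast
    obtain y where y: "y \<in> L.threads" "restrict y {1..} \<in> V"
      using ne(2) sub(2) from_limit by blast
    have V_iff: "restrict z {1..} \<in> V \<longleftrightarrow> restrict z {1..} \<notin> U" if "z \<in> L.threads" for z
      using in_limit[OF that] cover disj by (auto simp: topspace_cob_limit)
    have "restrict y {1..} \<in> U"
    proof (rule L.locally_constant_on_threads[of "\<lambda>z. restrict z {1..} \<in> U", OF _ x(1) y(1) x(2)])
      fix z assume z: "z \<in> L.threads"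
      show "\<exists>n W. openin (distance_topology (cob_set X d n) (cob_dist X d n)) W \<and> z n \<in> W \<and>
          (\<forall>w\<in>L.threads. w n \<in> W \<longrightarrow> (restrict w {1..} \<in> U) = (restrict z {1..} \<in> U))"
      proof (cases "restrict z {1..} \<in> U")
        case True
        then show ?thesis using nbhd[OF U z] by (metis (no_types, lifting))
      next
        case False
        then have "restrict z {1..} \<in> V" using V_iff[OF z] by simp
        from nbhd[OF V z this] show ?thesis using V_iff False by (metis (no_types, lifting))
      qed
    qed
    then show False using y disj by blast
  qed
qed

lemma continuous_map_cob_limit_projection:
  "1 \<le> n \<Longrightarrow> continuous_map (cob_limit X d) (cob_topology X d n) (\<lambda>x. x n)"
  unfolding cob_limit_def
  by (intro continuous_map_from_subtopology continuous_map_product_projection) simp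

text \<open>The coordinates of index \<open>n + 1\<close> of the points of \<open>S\<close> form a separable connected set, so their
  compressions, the coordinates of index \<open>n\<close>, coincide. This needs the stage \<open>n\<close> to be a metric
  space, that is \<open>n \<ge> 1\<close>.\<close>

lemma separable_connected_in_cob_limit:
  assumes con: "connectedin (cob_limit X d) S"
    and sep: "separable_space (subtopology (cob_limit X d) S)"
    and xy: "x \<in> S" "y \<in> S"
  shows "x = y"
proof
  fix n
  have S: "S \<subseteq> cob_limit_set X d"
    using connectedin_subset_topspace[OF con] by (simp add: topspace_cob_limit)
  show "x n = y n"
  proof (cases n)
    case 0
    then show ?thesis
      using subsetD[OF S xy(1)] subsetD[OF S xy(2)] by (simp add: cob_limit_set_iff)
  next
    case (Suc m)
    let ?T = "cob_topology X d (Suc n)" and ?C = "(\<lambda>x. x (Suc n)) ` S"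
    have T: "?T = distance_topology (cobweb (cob_set X d n) (cob_dist X d n)) (graph_dist (cob_set X d n))"
      by (simp add: cob_topology_eq_distance_topology)
    have cont: "continuous_map (cob_limit X d) ?T (\<lambda>x. x (Suc n))"
      by (rule continuous_map_cob_limit_projection) simp
    have C: "connectedin ?T ?C"
      by (rule connectedin_continuous_map_image[OF cont con])
    have "separable_space (subtopology ?T ?C)"
    proof (rule separable_space_continuous_map_image[OF sep, where f = "\<lambda>x. x (Suc n)"])
      show "continuous_map (subtopology (cob_limit X d) S) (subtopology ?T ?C) (\<lambda>x. x (Suc n))"
        using cont by (auto simp: continuous_map_in_subtopology continuous_map_from_subtopology)
      show "(\<lambda>x. x (Suc n)) ` topspace (subtopology (cob_limit X d) S) = topspace (subtopology ?T ?C)"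
        using S connectedin_subset_topspace[OF C] by (auto simp: topspace_cob_limit)
    qed
    moreover have "Metric_space (cob_set X d n) (cob_dist X d n)"
      unfolding Suc by (rule Metric_space_cob)
    ultimately have "compression (cob_set X d n) (cob_dist X d n) (x (Suc n)) =
        compression (cob_set X d n) (cob_dist X d n) (y (Suc n))"
      using compression_constant_on_separable_connected C xy unfolding T by blast
    moreover have "compression (cob_set X d n) (cob_dist X d n) (v (Suc n)) = v n" if "v \<in> S" for v
    proof -
      have "1 \<le> n" by (simp add: Suc)
      then show ?thesis using subsetD[OF S that] unfolding cob_limit_set_iff by blast
    qed
    ultimately show ?thesis using xy by metis
  qed
qed

lemma closedin_cob_limit_set:
  assumes X: "distance_space X d"
  shows "closedin (product_topology (cob_topology X d) {1..}) (cob_limit_set X d)"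
proof -
  let ?P = "product_topology (cob_topology X d) {1..}"
  let ?E = "\<lambda>n. {x \<in> topspace ?P. compression (cob_set X d n) (cob_dist X d n) (x (Suc n)) = x n}"
  have "closedin ?P (?E n)" if n: "1 \<le> n" for n
  proof (rule closedin_continuous_maps_eq)
    obtain m where m: "n = Suc m" using n by (cases n) auto
    show "Hausdorff_space (cob_topology X d n)"
      unfolding cob_topology_def m by (rule Metric_space.Hausdorff_space_mtopology[OF Metric_space_cob])
    show "continuous_map ?P (cob_topology X d n) (\<lambda>x. x n)"
      using n by (intro continuous_map_product_projection) simp
    have "continuous_map ?P (cob_topology X d (Suc n)) (\<lambda>x. x (Suc n))"
      by (intro continuous_map_product_projection) simp
    moreover have "continuous_map (cob_topology X d (Suc n)) (cob_topology X d n)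
        (compression (cob_set X d n) (cob_dist X d n))"
      using compression_continuous[OF distance_space_cob[OF X, of n]] n
      by (simp add: cob_topology_eq_distance_topology)
    ultimately show "continuous_map ?P (cob_topology X d n)
        (\<lambda>x. compression (cob_set X d n) (cob_dist X d n) (x (Suc n)))"
      by (rule continuous_map_compose[unfolded o_def])
  qed
  then have "closedin ?P (\<Inter>n\<in>{1..}. ?E n)" by (intro closedin_INT) auto
  moreover have "topspace ?P = (\<Pi>\<^sub>E n\<in>{1..}. cob_set X d n)"
    unfolding topspace_product_topology by (rule PiE_cong) (simp add: topspace_cob_topology)
  then have "(\<Inter>n\<in>{1..}. ?E n) = cob_limit_set X d"
    by (auto simp: cob_limit_set_def)
  ultimately show ?thesis by simp
qed

lemma completely_metrizable_cob_limit:
  assumes X: "distance_space X d"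
  shows "completely_metrizable_space (cob_limit X d)"
proof -
  have "completely_metrizable_space (cob_topology X d n)" if n: "1 \<le> n" for n
  proof -
    obtain m where m: "n = Suc m" using n by (cases n) auto
    have "Metric_space.mcomplete (cob_set X d n) (cob_dist X d n)"
      using mcomplete_cobweb[OF distance_space_cob[OF X, of m]] by (simp add: m)
    then show ?thesis
      unfolding cob_topology_def m
      by (rule Metric_space.completely_metrizable_space_mtopology[OF Metric_space_cob])
  qed
  then have "completely_metrizable_space (product_topology (cob_topology X d) {1..})"
    by (simp add: completely_metrizable_space_product_topology countable_subset[OF subset_UNIV])
  then show ?thesis
    unfolding cob_limit_def
    using closedin_cob_limit_set[OF X] by (rule completely_metrizable_space_closedin)
qed

theorem corollary3p3:
  fixes X :: "'a set" and d :: "'a \<Rightarrow> 'a \<Rightarrow> real"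
  assumes "distance_space X d"
    and "connected_space (distance_topology X d)"
    and "\<exists>x\<in>X. \<exists>y\<in>X. x \<noteq> y"
  shows "nonseparably_connected (cob_limit X d) \<and> completely_metrizable_space (cob_limit X d)"
proof
  show "nonseparably_connected (cob_limit X d)"
    unfolding nonseparably_connected_def
  proof (intro conjI allI impI)
    show "connected_space (cob_limit X d)"
      using assms(1,2) by (rule connected_cob_limit)
    fix S assume S: "S \<noteq> {} \<and> connectedin (cob_limit X d) S \<and> separable_space (subtopology (cob_limit X d) S)"
    then obtain x where "x \<in> S" by blast
    then have "S = {x}"
      using separable_connected_in_cob_limit S by blast
    then show "\<exists>x. S = {x}" by (intro exI[of _ x])
  qed
  show "completely_metrizable_space (cob_limit X d)"
    using assms(1) by (rule completely_metrizable_cob_limit)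
qed

end
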